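(* Let $G$ be a torsion-free abelian group of finite rank, and let all coefficient groups below have trivial $G$-action. Then: (1) $H^2_S(G,\mathbb{C}^* )=0$. (2) $H^2_S(G,\mathbb{R}_{>0})=H^2_S(G,\mathbb{R})=H^2_S(G,\mathbb{R}/\mathbb{Z})=0$. (3) $H^2_S(G,\mathbb{Q})=H^2_S(G,\mathbb{Q}/\mathbb{Z})=H^2_S(G,\mathbb{Z}[1/p]/\mathbb{Z})=0$ for every prime number $p$. (4) If $\operatorname{rank}G=1$, then $H^2(G,\mathbb{Q})=H^2(G,\mathbb{Q}/\mathbb{Z})=H^2(G,\mathbb{Z}[1/p]/\mathbb{Z})=0$ for every prime number $p$.
   Context: The rank of $G$ is $\dim_{\mathbb{Q}}(\mathbb{Q}\otimes_{\mathbb{Z}}G)$. $\mathbb{C}^*$ and $\mathbb{R}_{>0}$ are groups under multiplication; the other coefficient groups are additive. For an abelian group $A$ (written additively) with trivial $G$-action, $Z^2(G,A)$ is the group of functions $\varphi:G\times G\to A$ with $\varphi(g,h)-\varphi(f+g,h)+\varphi(f,g+h)-\varphi(f,g)=0$ for all $f,g,h\in G$; $B^2(G,A)\subset Z^2(G,A)$ is the subgroup of functions $(f,g)\mapsto\beta(g)-\beta(f+g)+\beta(f)$ with $\beta:G\to A$ any function; $H^2(G,A)=Z^2(G,A)/B^2(G,A)$ is the usual second group cohomology. $Z^2_S(G,A)$ and $B^2_S(G,A)$ are the subgroups of those $\varphi$ in $Z^2(G,A)$, respectively $B^2(G,A)$, with $\varphi(g,h)=\varphi(h,g)$ for all $g,h$,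 and $H^2_S(G,A)=Z^2_S(G,A)/B^2_S(G,A)$. *)

theory Defs
  imports
    Complex_Main
    "HOL-Computational_Algebra.Primes"
    "HOL-Algebra.Elementary_Groups"
    "HOL-Algebra.Product_Groups"
    "HOL-Algebra.Free_Abelian_Groups"
    "Jordan_Normal_Form.VS_Connect"
begin

text \<open>
  Abelian groups are carried by \<open>comm_group\<close> of HOL-Algebra and hence written multiplicatively;
  \<open>\<otimes>\<close>, \<open>inv\<close> and \<open>\<one>\<close> stand for the sum, the negative and the zero of additive notation.
\<close>

definition torsion_free :: "('g, 'm) monoid_scheme \<Rightarrow> bool" where
  "torsion_free G \<longleftrightarrow>
     (\<forall>x\<in>carrier G. \<forall>n::nat. 0 < n \<longrightarrow> x [^]\<^bsub>G\<^esub> n = \<one>\<^bsub>G\<^esub> \<longrightarrow> x = \<one>\<^bsub>G\<^esub>)"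

text \<open>
  The tensor product of the additive group of rationals with \<open>G\<close> over the integers is the free
  abelian group on all pairs \<open>(q, g)\<close> modulo the subgroup generated by the bilinearity relations.
  A rational scalar \<open>q\<close> acts by sending the class of \<open>(r, g)\<close> to the class of \<open>(q * r, g)\<close>.
\<close>

abbreviation tensor_free :: "('g, 'm) monoid_scheme \<Rightarrow> (rat \<times> 'g \<Rightarrow>\<^sub>0 int) monoid" where
  "tensor_free G \<equiv> free_Abelian_group (UNIV \<times> carrier G)"

definition tensor_relations :: "('g, 'm) monoid_scheme \<Rightarrow> (rat \<times> 'g \<Rightarrow>\<^sub>0 int) set" where
  "tensor_relations G =
     {frag_of (q + r, g) - frag_of (q, g) - frag_of (r, g) | q r g. g \<in> carrier G} \<union>
     {frag_of (q, g \<otimes>\<^bsub>G\<^esub> h) - frag_of (q, g) - frag_of (q, h) | q g h.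
        g \<in> carrier G \<and> h \<in> carrier G}"

definition tensor_null :: "('g, 'm) monoid_scheme \<Rightarrow> (rat \<times> 'g \<Rightarrow>\<^sub>0 int) set" where
  "tensor_null G = generate (tensor_free G) (tensor_relations G)"

definition tensor_scale :: "rat \<Rightarrow> (rat \<times> 'g \<Rightarrow>\<^sub>0 int) \<Rightarrow> (rat \<times> 'g \<Rightarrow>\<^sub>0 int)" where
  "tensor_scale q = frag_extend (\<lambda>(r, g). frag_of (q * r, g))"

text \<open>
  The union in the scalar multiplication is over representatives of the coset \<open>X\<close>; all of them give
  the same coset, see \<open>rat_tensor_smult\<close> below. The record fields \<open>mult\<close> and \<open>one\<close> play no role in a
  module.
\<close>

definition rat_tensor ::
    "('g, 'm) monoid_scheme \<Rightarrow> (rat, (rat \<times> 'g \<Rightarrow>\<^sub>0 int) set) module" where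
  "rat_tensor G =
     \<lparr>carrier = carrier (tensor_free G Mod tensor_null G),
      monoid.mult = undefined,
      one = undefined,
      zero = \<one>\<^bsub>tensor_free G Mod tensor_null G\<^esub>,
      add = monoid.mult (tensor_free G Mod tensor_null G),
      smult = (\<lambda>q X. \<Union>x\<in>X. tensor_null G #>\<^bsub>tensor_free G\<^esub> tensor_scale q x)\<rparr>"

definition finite_rank :: "('g, 'm) monoid_scheme \<Rightarrow> bool" where
  "finite_rank G \<longleftrightarrow> vectorspace.fin_dim (class_ring :: rat ring) (rat_tensor G)"

definition group_rank :: "('g, 'm) monoid_scheme \<Rightarrow> nat" where
  "group_rank G = vectorspace.dim (class_ring :: rat ring) (rat_tensor G)"

context
  fixes G :: "('g, 'm) monoid_scheme" (structure)
  assumes G: "comm_group G"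
begin

interpretation G: comm_group G by (rule G)

lemma tensor_relations_subset: "tensor_relations G \<subseteq> carrier (tensor_free G)"
proof -
  have diff: "x - y \<in> carrier (tensor_free G)"
    if "x \<in> carrier (tensor_free G)" "y \<in> carrier (tensor_free G)" for x y :: "rat \<times> 'g \<Rightarrow>\<^sub>0 int"
    using that keys_diff[of x y] by auto
  show ?thesis
    unfolding tensor_relations_def by (auto simp del: carrier_free_Abelian_group_iff intro!: diff)
qed

lemma tensor_null_subgroup: "subgroup (tensor_null G) (tensor_free G)"
  unfolding tensor_null_def
  by (rule group.generate_is_subgroup[OF group_free_Abelian_group tensor_relations_subset])

lemma tensor_null_normal: "tensor_null G \<lhd> tensor_free G"
  using comm_group.normal_iff_subgroup[OF abelian_free_Abelian_group] tensor_null_subgroup by blast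

lemma tensor_scale_closed:
  assumes "x \<in> carrier (tensor_free G)"
  shows "tensor_scale q x \<in> carrier (tensor_free G)"
  using assms keys_frag_extend[of "\<lambda>(r, g). frag_of (q * r, g)" x]
  unfolding tensor_scale_def carrier_free_Abelian_group_iff by (force simp: split_beta)

lemma tensor_scale_add: "tensor_scale q (x + y) = tensor_scale q x + tensor_scale q y"
  unfolding tensor_scale_def by (rule frag_extend_add)

lemma tensor_scale_diff: "tensor_scale q (x - y) = tensor_scale q x - tensor_scale q y"
  unfolding tensor_scale_def by (rule frag_extend_diff)

lemma tensor_scale_zero: "tensor_scale q 0 = 0"
  unfolding tensor_scale_def by (rule frag_extend_0)

lemma tensor_scale_frag_of: "tensor_scale q (frag_of (r, g)) = frag_of (q * r, g)"
  unfolding tensor_scale_def by simp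

lemma tensor_scale_null:
  assumes "x \<in> tensor_null G"
  shows "tensor_scale q x \<in> tensor_null G"
proof -
  interpret F: comm_group "tensor_free G" by (rule abelian_free_Abelian_group)
  have rel: "tensor_scale q x \<in> tensor_relations G" if "x \<in> tensor_relations G" for x
    using that unfolding tensor_relations_def
    by (fastforce simp: tensor_scale_diff tensor_scale_frag_of distrib_left)
  show ?thesis
    using assms unfolding tensor_null_def
  proof (induction rule: generate.induct)
    case one
    show ?case using generate.one[of "tensor_free G" "tensor_relations G"]
      by (simp add: tensor_scale_def)
  next
    case (incl h)
    then show ?case by (intro generate.incl rel)
  next
    case (inv h)
    have k: "Poly_Mapping.keys h \<subseteq> UNIV \<times> carrier G"
        "Poly_Mapping.keys (tensor_scale q h) \<subseteq> UNIV \<times> carrier G"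
      using subsetD[OF tensor_relations_subset inv] subsetD[OF tensor_relations_subset rel[OF inv]]
      by simp_all
    have "tensor_scale q (- h) = - tensor_scale q h"
      unfolding tensor_scale_def by (rule frag_extend_minus)
    then show ?case using generate.inv[OF rel[OF inv], of "tensor_free G"] k by simp
  next
    case (eng h1 h2)
    then show ?case
      using generate.eng[of "tensor_scale q h1" "tensor_free G" "tensor_relations G" "tensor_scale q h2"]
      by (simp add: tensor_scale_add)
  qed
qed

lemma rat_tensor_smult:
  assumes x: "x \<in> carrier (tensor_free G)"
  shows "q \<odot>\<^bsub>rat_tensor G\<^esub> (tensor_null G #>\<^bsub>tensor_free G\<^esub> x) =
         tensor_null G #>\<^bsub>tensor_free G\<^esub> tensor_scale q x"
proof -
  interpret N: normal "tensor_null G" "tensor_free G" by (rule tensor_null_normal)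
  have rep: "tensor_null G #>\<^bsub>tensor_free G\<^esub> tensor_scale q y =
        tensor_null G #>\<^bsub>tensor_free G\<^esub> tensor_scale q x"
    if "y \<in> tensor_null G #>\<^bsub>tensor_free G\<^esub> x" for y
  proof -
    from that obtain n where n: "n \<in> tensor_null G" "y = n + x" unfolding r_coset_def by auto
    then have "tensor_scale q y \<in> tensor_null G #>\<^bsub>tensor_free G\<^esub> tensor_scale q x"
      unfolding r_coset_def using tensor_scale_null[OF n(1)] by (auto simp: tensor_scale_add)
    then show ?thesis
      using N.repr_independence[OF _ tensor_scale_closed[OF x] tensor_null_subgroup] by simp
  qed
  have "x \<in> tensor_null G #>\<^bsub>tensor_free G\<^esub> x"
    by (rule N.rcos_self[OF x tensor_null_subgroup])
  then have ne: "tensor_null G #>\<^bsub>tensor_free G\<^esub> x \<noteq> {}" by blast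
  have "q \<odot>\<^bsub>rat_tensor G\<^esub> X = (\<Union>y\<in>X. tensor_null G #>\<^bsub>tensor_free G\<^esub> tensor_scale q y)" for X
    unfolding rat_tensor_def by simp
  then show ?thesis using SUP_eq_const[OF ne rep] by (simp only:)
qed

lemma vectorspace_rat_tensor: "vectorspace (class_ring :: rat ring) (rat_tensor G)"
proof -
  interpret F: comm_group "tensor_free G" by (rule abelian_free_Abelian_group)
  interpret N: normal "tensor_null G" "tensor_free G" by (rule tensor_null_normal)
  let ?T = "rat_tensor G" and ?N = "tensor_null G" and ?F = "tensor_free G"
  have Q: "comm_group (?F Mod ?N)"
    using tensor_null_subgroup by (rule F.abelian_FactGroup)
  have add: "(?N #>\<^bsub>?F\<^esub> x) \<oplus>\<^bsub>?T\<^esub> (?N #>\<^bsub>?F\<^esub> y) = ?N #>\<^bsub>?F\<^esub> (x + y)"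
    if "x \<in> carrier ?F" "y \<in> carrier ?F" for x y
    using N.rcos_sum[OF that] unfolding rat_tensor_def FactGroup_def by simp
  have ex: "\<exists>x\<in>carrier ?F. X = ?N #>\<^bsub>?F\<^esub> x" if "X \<in> carrier ?T" for X
    using that unfolding rat_tensor_def FactGroup_def RCOSETS_def by auto
  have closed: "?N #>\<^bsub>?F\<^esub> x \<in> carrier ?T" if "x \<in> carrier ?F" for x
    using that unfolding rat_tensor_def FactGroup_def RCOSETS_def by auto
  have abelian: "abelian_group ?T"
  proof -
    interpret Q: comm_group "?F Mod ?N" by (rule Q)
    have T: "carrier ?T = carrier (?F Mod ?N)" "\<zero>\<^bsub>?T\<^esub> = \<one>\<^bsub>?F Mod ?N\<^esub>"
        "X \<oplus>\<^bsub>?T\<^esub> Y = X \<otimes>\<^bsub>?F Mod ?N\<^esub> Y" for X Y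
      unfolding rat_tensor_def by simp_all
    show ?thesis
    proof (rule abelian_groupI)
      fix X assume "X \<in> carrier ?T"
      then show "\<exists>Y\<in>carrier ?T. Y \<oplus>\<^bsub>?T\<^esub> X = \<zero>\<^bsub>?T\<^esub>"
        unfolding T using Q.l_inv_ex by blast
    qed (simp_all only: T Q.m_closed Q.one_closed Q.m_assoc Q.l_one, rule Q.m_comm)
  qed
  have plus: "x + y \<in> carrier ?F" if "x \<in> carrier ?F" "y \<in> carrier ?F" for x y
    using F.m_closed[OF that] by simp
  have null_diff: "u - v \<in> ?N" if "u \<in> ?N" "v \<in> ?N" for u v
  proof -
    have "Poly_Mapping.keys v \<subseteq> UNIV \<times> carrier G"
      using subgroup.mem_carrier[OF tensor_null_subgroup that(2)] by simp
    then show ?thesis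
      using subgroup.m_closed[OF tensor_null_subgroup that(1)
          subgroup.m_inv_closed[OF tensor_null_subgroup that(2)]] by simp
  qed
  have l_distr: "?N #>\<^bsub>?F\<^esub> tensor_scale (a + b) x =
      ?N #>\<^bsub>?F\<^esub> (tensor_scale a x + tensor_scale b x)" if "x \<in> carrier ?F" for a b x
  proof -
    have "tensor_scale (a + b) x - (tensor_scale a x + tensor_scale b x) \<in> ?N"
    proof -
      from that have "Poly_Mapping.keys x \<subseteq> UNIV \<times> carrier G" by simp
      then show ?thesis
      proof (induction x rule: free_Abelian_group_induct[consumes 1, case_names zero diff base])
        case zero
        show ?case using N.one_closed by (simp add: tensor_scale_def)
      next
        case (diff x y)
        have "tensor_scale (a + b) (x - y) - (tensor_scale a (x - y) + tensor_scale b (x - y)) =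
            (tensor_scale (a + b) x - (tensor_scale a x + tensor_scale b x)) -
            (tensor_scale (a + b) y - (tensor_scale a y + tensor_scale b y))"
          by (simp add: tensor_scale_diff)
        then show ?case using null_diff[OF diff(3,4)] by (simp only:)
      next
        case (base z)
        then obtain r g where z: "z = (r, g)" "g \<in> carrier G" by auto
        have "frag_of (a * r + b * r, g) - frag_of (a * r, g) - frag_of (b * r, g) \<in> ?N"
          unfolding tensor_null_def tensor_relations_def by (rule generate.incl) (use z in blast)
        then show ?case unfolding z tensor_scale_frag_of by (simp add: distrib_right diff_diff_eq)
      qed
    qed
    then have "tensor_scale (a + b) x - (tensor_scale a x + tensor_scale b x) +
        (tensor_scale a x + tensor_scale b x) \<in> ?N #>\<^bsub>?F\<^esub> (tensor_scale a x + tensor_scale b x)"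
      unfolding r_coset_def mult_free_Abelian_group by blast
    then have "tensor_scale (a + b) x \<in> ?N #>\<^bsub>?F\<^esub> (tensor_scale a x + tensor_scale b x)"
      by (simp only: diff_add_cancel)
    then show ?thesis
      using F.repr_independence[OF _ plus[OF tensor_scale_closed[OF that] tensor_scale_closed[OF that]]
          tensor_null_subgroup] by simp
  qed
  have assoc: "tensor_scale (a * b) x = tensor_scale a (tensor_scale b x)"
    if "x \<in> carrier ?F" for a b x
    using that unfolding carrier_free_Abelian_group_iff
    by (induction x rule: free_Abelian_group_induct[consumes 1, case_names zero diff base])
       (auto simp: tensor_scale_zero tensor_scale_diff tensor_scale_frag_of mult.assoc)
  have unit: "tensor_scale 1 x = x" if "x \<in> carrier ?F" for x
    using that unfolding carrier_free_Abelian_group_iff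
    by (induction x rule: free_Abelian_group_induct[consumes 1, case_names zero diff base])
       (auto simp: tensor_scale_zero tensor_scale_diff tensor_scale_frag_of)
  have "Module.module (class_ring :: rat ring) ?T"
  proof (rule moduleI)
    show "cring (class_ring :: rat ring)"
      using class_field[where ?'a = rat] by (simp add: field_def domain_def)
    show "abelian_group ?T" by (rule abelian)
  next
    fix a and X assume "X \<in> carrier ?T"
    then obtain x where x: "x \<in> carrier ?F" "X = ?N #>\<^bsub>?F\<^esub> x" using ex by blast
    then show "a \<odot>\<^bsub>?T\<^esub> X \<in> carrier ?T"
      using rat_tensor_smult closed tensor_scale_closed by auto
  next
    fix a b and X assume "X \<in> carrier ?T"
    then obtain x where x: "x \<in> carrier ?F" "X = ?N #>\<^bsub>?F\<^esub> x" using ex by blast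
    show "(a \<oplus>\<^bsub>class_ring\<^esub> b) \<odot>\<^bsub>?T\<^esub> X = a \<odot>\<^bsub>?T\<^esub> X \<oplus>\<^bsub>?T\<^esub> b \<odot>\<^bsub>?T\<^esub> X"
      using x by (simp only: rat_tensor_smult add tensor_scale_closed class_ring_simps l_distr)
    show "(a \<otimes>\<^bsub>class_ring\<^esub> b) \<odot>\<^bsub>?T\<^esub> X = a \<odot>\<^bsub>?T\<^esub> (b \<odot>\<^bsub>?T\<^esub> X)"
      using x by (simp only: rat_tensor_smult tensor_scale_closed class_ring_simps assoc)
  next
    fix a and X Y assume "X \<in> carrier ?T" "Y \<in> carrier ?T"
    then obtain x y where xy: "x \<in> carrier ?F" "X = ?N #>\<^bsub>?F\<^esub> x" "y \<in> carrier ?F" "Y = ?N #>\<^bsub>?F\<^esub> y"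
      using ex by meson
    show "a \<odot>\<^bsub>?T\<^esub> (X \<oplus>\<^bsub>?T\<^esub> Y) = a \<odot>\<^bsub>?T\<^esub> X \<oplus>\<^bsub>?T\<^esub> a \<odot>\<^bsub>?T\<^esub> Y"
      using xy by (simp only: rat_tensor_smult add plus tensor_scale_closed tensor_scale_add)
  next
    fix X assume "X \<in> carrier ?T"
    then obtain x where x: "x \<in> carrier ?F" "X = ?N #>\<^bsub>?F\<^esub> x" using ex by blast
    then show "\<one>\<^bsub>class_ring\<^esub> \<odot>\<^bsub>?T\<^esub> X = X"
      by (simp only: rat_tensor_smult unit class_ring_simps)
  qed
  then show ?thesis
    using class_field[where ?'a = rat] by (simp add: vectorspace_def)
qed

end

text \<open>
  Cochains are extensional functions on \<open>carrier G \<times> carrier G\<close> with the pointwise group operation.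
\<close>

definition cochain_group ::
    "('g, 'm) monoid_scheme \<Rightarrow> ('a, 'n) monoid_scheme \<Rightarrow> ('g \<times> 'g \<Rightarrow> 'a) monoid" where
  "cochain_group G A = product_group (carrier G \<times> carrier G) (\<lambda>_. A)"

definition Z2 ::
    "('g, 'm) monoid_scheme \<Rightarrow> ('a, 'n) monoid_scheme \<Rightarrow> ('g \<times> 'g \<Rightarrow> 'a) set" where
  "Z2 G A = {\<phi> \<in> carrier (cochain_group G A).
     \<forall>f\<in>carrier G. \<forall>g\<in>carrier G. \<forall>h\<in>carrier G.
       \<phi> (g, h) \<otimes>\<^bsub>A\<^esub> inv\<^bsub>A\<^esub> \<phi> (f \<otimes>\<^bsub>G\<^esub> g, h) \<otimes>\<^bsub>A\<^esub> \<phi> (f, g \<otimes>\<^bsub>G\<^esub> h) \<otimes>\<^bsub>A\<^esub> inv\<^bsub>A\<^esub> \<phi> (f, g) = \<one>\<^bsub>A\<^esub>}"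

definition B2 ::
    "('g, 'm) monoid_scheme \<Rightarrow> ('a, 'n) monoid_scheme \<Rightarrow> ('g \<times> 'g \<Rightarrow> 'a) set" where
  "B2 G A = {\<phi> \<in> carrier (cochain_group G A).
     \<exists>\<beta> \<in> carrier G \<rightarrow> carrier A. \<forall>f\<in>carrier G. \<forall>g\<in>carrier G.
       \<phi> (f, g) = \<beta> g \<otimes>\<^bsub>A\<^esub> inv\<^bsub>A\<^esub> \<beta> (f \<otimes>\<^bsub>G\<^esub> g) \<otimes>\<^bsub>A\<^esub> \<beta> f}"

definition symmetric_on :: "('g, 'm) monoid_scheme \<Rightarrow> ('g \<times> 'g \<Rightarrow> 'a) \<Rightarrow> bool" where
  "symmetric_on G \<phi> \<longleftrightarrow> (\<forall>g\<in>carrier G. \<forall>h\<in>carrier G. \<phi> (g, h) = \<phi> (h, g))"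

definition Z2_sym ::
    "('g, 'm) monoid_scheme \<Rightarrow> ('a, 'n) monoid_scheme \<Rightarrow> ('g \<times> 'g \<Rightarrow> 'a) set" where
  "Z2_sym G A = {\<phi> \<in> Z2 G A. symmetric_on G \<phi>}"

definition B2_sym ::
    "('g, 'm) monoid_scheme \<Rightarrow> ('a, 'n) monoid_scheme \<Rightarrow> ('g \<times> 'g \<Rightarrow> 'a) set" where
  "B2_sym G A = {\<phi> \<in> B2 G A. symmetric_on G \<phi>}"

definition H2 ::
    "('g, 'm) monoid_scheme \<Rightarrow> ('a, 'n) monoid_scheme \<Rightarrow> ('g \<times> 'g \<Rightarrow> 'a) set monoid" where
  "H2 G A = (cochain_group G A)\<lparr>carrier := Z2 G A\<rparr> Mod B2 G A"

definition H2_sym ::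
    "('g, 'm) monoid_scheme \<Rightarrow> ('a, 'n) monoid_scheme \<Rightarrow> ('g \<times> 'g \<Rightarrow> 'a) set monoid" where
  "H2_sym G A = (cochain_group G A)\<lparr>carrier := Z2_sym G A\<rparr> Mod B2_sym G A"

definition additive_group :: "'a::ab_group_add set \<Rightarrow> 'a monoid" where
  "additive_group S = \<lparr>carrier = S, monoid.mult = (+), one = 0\<rparr>"

definition multiplicative_group :: "'a::field set \<Rightarrow> 'a monoid" where
  "multiplicative_group S = \<lparr>carrier = S, monoid.mult = (*), one = 1\<rparr>"

definition complex_units :: "complex monoid" where
  "complex_units = multiplicative_group (UNIV - {0})"

definition pos_reals :: "real monoid" where
  "pos_reals = multiplicative_group {0<..}"

definition real_add :: "real monoid" where
  "real_add = additive_group UNIV"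

definition real_mod_int :: "real set monoid" where
  "real_mod_int = real_add Mod \<int>"

definition rat_add :: "rat monoid" where
  "rat_add = additive_group UNIV"

definition rat_mod_int :: "rat set monoid" where
  "rat_mod_int = rat_add Mod \<int>"

definition int_adjoin_inverse :: "nat \<Rightarrow> rat monoid" where
  "int_adjoin_inverse p = additive_group {of_int a / of_nat p ^ n | a n. True}"

definition int_adjoin_inverse_mod_int :: "nat \<Rightarrow> rat set monoid" where
  "int_adjoin_inverse_mod_int p = int_adjoin_inverse p Mod \<int>"

end

theory Submission
  imports Defs
begin

text \<open>
  All the coefficient groups \<open>A\<close> are divisible. By Zorn's lemma, homomorphisms into a divisible group
  extend from subgroups of abelian groups. A symmetric cocycle \<open>\<phi>\<close> makes \<open>A \<times> G\<close> an abelian extension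
  of \<open>G\<close> by \<open>A\<close>; divisibility provides a retraction of it onto \<open>A\<close>, and this exhibits \<open>\<phi>\<close> as a
  coboundary. The rank of \<open>G\<close> matters only in the last part: in rank one, a torsion-free \<open>G\<close> embeds
  into the rationals, so any two of its elements are powers of a single one, their lifts to the
  extension group commute, and every cocycle is symmetric.
\<close>

section \<open>Divisible groups\<close>

text \<open>In other terms, \<open>H2_sym G A\<close> is Ext(G, A), and a divisible \<open>A\<close>
  is an injective abelian group. Symmetry is indispensable to this argument: over Z^2 the bilinear
  map sending ((a, b), (c, d)) to a d is a rational cocycle that is not symmetric, hence not a
  coboundary, since coboundaries on a commutative group are symmetric. Partial homomorphisms are
  represented by their graphs, so that extending one means enlarging a subgroup of a product.
  Cocycles are not normalised, which is why the value of \<phi> at the pair of units appears as a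
  correction in the unit of the extension group and in the embedding of \<open>A\<close>. The
  obstacle in rank one is that the rank refers to a quotient of a free abelian group, where it is
  hard to see that a class is nonzero. Rational characters of \<open>G\<close> overcome it: the same
  extension theorem, applied to the divisible group of rationals, gives one that does not vanish at
  a prescribed nontrivial element, and each character induces a linear functional on the tensor
  product.\<close>

definition divisible :: "('a, 'n) monoid_scheme \<Rightarrow> bool" where
  "divisible A \<longleftrightarrow> (\<forall>a\<in>carrier A. \<forall>n::nat. 0 < n \<longrightarrow> (\<exists>b\<in>carrier A. b [^]\<^bsub>A\<^esub> n = a))"

lemma DirProd_int_pow:
  assumes "group G" "group H" "x \<in> carrier G" "y \<in> carrier H"
  shows "(x, y) [^]\<^bsub>G \<times>\<times> H\<^esub> (n::int) = (x [^]\<^bsub>G\<^esub> n, y [^]\<^bsub>H\<^esub> n)"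
proof -
  have P: "group (G \<times>\<times> H)" using assms(1,2) by (rule DirProd_group)
  have fst: "fst \<in> hom (G \<times>\<times> H) G" and snd: "snd \<in> hom (G \<times>\<times> H) H"
    by (auto simp: hom_def)
  have "(x, y) \<in> carrier (G \<times>\<times> H)" using assms by simp
  from hom_int_pow[OF fst this P assms(1), of n] hom_int_pow[OF snd this P assms(2), of n]
  show ?thesis by (metis fst_conv prod.collapse snd_conv)
qed

lemma DirProd_comm_group:
  assumes "comm_group G" "comm_group H"
  shows "comm_group (G \<times>\<times> H)"
proof -
  interpret G: comm_group G by fact
  interpret H: comm_group H by fact
  show ?thesis
    by (intro group.group_comm_groupI DirProd_group G.is_group H.is_group)
       (auto simp: G.m_comm H.m_comm)
qed

text \<open>Commutativity allows the powers of \<open>z\<close> to be collected, so this is the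
  subgroup generated by \<open>S\<close> and \<open>z\<close>. It serves to adjoin one pair to the
  graph of a partial homomorphism.\<close>

lemma subgroup_insert_multiples:
  assumes "comm_group P" "subgroup S P" "z \<in> carrier P"
  shows "subgroup {s \<otimes>\<^bsub>P\<^esub> z [^]\<^bsub>P\<^esub> (n::int) | s n. s \<in> S} P" (is "subgroup ?S' P")
proof -
  interpret P: comm_group P by fact
  interpret S: subgroup S P by fact
  note [simp] = \<open>z \<in> carrier P\<close>
  show ?thesis
  proof (rule P.subgroupI)
    show "?S' \<subseteq> carrier P" by auto
    show "?S' \<noteq> {}" using S.one_closed by blast
  next
    fix u assume "u \<in> ?S'"
    then obtain s n where s: "s \<in> S" "u = s \<otimes>\<^bsub>P\<^esub> z [^]\<^bsub>P\<^esub> (n::int)" by blast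
    then have "inv\<^bsub>P\<^esub> u = inv\<^bsub>P\<^esub> s \<otimes>\<^bsub>P\<^esub> z [^]\<^bsub>P\<^esub> (- n)"
      by (simp add: P.inv_mult P.int_pow_neg)
    with s(1) show "inv\<^bsub>P\<^esub> u \<in> ?S'" by blast
  next
    fix u v assume "u \<in> ?S'" "v \<in> ?S'"
    then obtain s n t m where s: "s \<in> S" "u = s \<otimes>\<^bsub>P\<^esub> z [^]\<^bsub>P\<^esub> (n::int)"
      and t: "t \<in> S" "v = t \<otimes>\<^bsub>P\<^esub> z [^]\<^bsub>P\<^esub> (m::int)" by blast
    have "u \<otimes>\<^bsub>P\<^esub> v = (s \<otimes>\<^bsub>P\<^esub> t) \<otimes>\<^bsub>P\<^esub> z [^]\<^bsub>P\<^esub> (n + m)"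
      using s t by (simp add: P.int_pow_mult P.m_ac)
    with s t show "u \<otimes>\<^bsub>P\<^esub> v \<in> ?S'" by blast
  qed
qed

text \<open>\<open>S\<close> is the graph of a homomorphism defined on a subgroup of
  \<open>E\<close>: for a subgroup, \<open>func\<close> is the same as being single-valued. A value
  \<open>a\<close> at \<open>x\<close> is admissible as soon as it agrees with \<open>S\<close> on
  every power of \<open>x\<close> in the domain, and these are the powers of the least positive
  one.\<close>

lemma divisible_extension_step:
  assumes E: "comm_group E" and A: "comm_group A" and div: "divisible A"
    and S: "subgroup S (E \<times>\<times> A)" and func: "\<And>a. (\<one>\<^bsub>E\<^esub>, a) \<in> S \<Longrightarrow> a = \<one>\<^bsub>A\<^esub>"
    and x: "x \<in> carrier E"
  shows "\<exists>S' a. subgroup S' (E \<times>\<times> A) \<and> S \<subseteq> S' \<and> (x, a) \<in> S'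
    \<and> (\<forall>a. (\<one>\<^bsub>E\<^esub>, a) \<in> S' \<longrightarrow> a = \<one>\<^bsub>A\<^esub>)"
proof -
  interpret E: comm_group E by fact
  interpret A: comm_group A by fact
  interpret P: comm_group "E \<times>\<times> A" using E A by (rule DirProd_comm_group)
  interpret S: subgroup S "E \<times>\<times> A" by fact
  have carr: "y \<in> carrier E" "b \<in> carrier A" if "(y, b) \<in> S" for y b
    using S.mem_carrier[OF that] by auto
  have mul: "(y \<otimes>\<^bsub>E\<^esub> z, b \<otimes>\<^bsub>A\<^esub> c) \<in> S" if "(y, b) \<in> S" "(z, c) \<in> S" for y b z c
    using S.m_closed[OF that] by simp
  have pow: "(y [^]\<^bsub>E\<^esub> n, b [^]\<^bsub>A\<^esub> n) \<in> S" if "(y, b) \<in> S" for y b and n :: int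
    using P.subgroup_int_pow_closed[OF S that, of n] carr[OF that]
      DirProd_int_pow[OF E.is_group A.is_group] by simp
  obtain a where a: "a \<in> carrier A"
    and a_pow: "\<And>(n::int) c. (x [^]\<^bsub>E\<^esub> n, c) \<in> S \<Longrightarrow> c = a [^]\<^bsub>A\<^esub> n"
  proof (cases "\<exists>n::nat. 0 < n \<and> (\<exists>c. (x [^]\<^bsub>E\<^esub> n, c) \<in> S)")
    \<comment> \<open>No positive power of \<open>x\<close> is in the domain, and by inversion no
      negative one either (hence the exponent \<open>sgn n\<close>), so the value at
      \<open>x\<close> is unconstrained and the unit will do.\<close>
    case False
    have "c = \<one>\<^bsub>A\<^esub> [^]\<^bsub>A\<^esub> n" if nc: "(x [^]\<^bsub>E\<^esub> n, c) \<in> S" for n :: int and c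
    proof -
      have "n = 0"
      proof (rule ccontr)
        assume n0: "n \<noteq> 0"
        have "(x [^]\<^bsub>E\<^esub> \<bar>n\<bar>, c [^]\<^bsub>A\<^esub> (sgn n)) \<in> S"
          using pow[OF nc, of "sgn n"] x by (simp add: E.int_pow_pow abs_sgn mult.commute)
        then have "(x [^]\<^bsub>E\<^esub> nat \<bar>n\<bar>, c [^]\<^bsub>A\<^esub> (sgn n)) \<in> S"
          by (metis abs_ge_zero int_nat_eq int_pow_int)
        then show False using False n0 by (metis zero_less_abs_iff zero_less_nat_eq)
      qed
      then show ?thesis using nc func by simp
    qed
    then show ?thesis using that by blast
  next
    case True
    define d where "d = (LEAST n::nat. 0 < n \<and> (\<exists>c. (x [^]\<^bsub>E\<^esub> n, c) \<in> S))"
    have d: "0 < d" "\<exists>c. (x [^]\<^bsub>E\<^esub> d, c) \<in> S"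
      using LeastI_ex[OF True] unfolding d_def by auto
    then obtain c0 where c0: "(x [^]\<^bsub>E\<^esub> int d, c0) \<in> S" by (auto simp: int_pow_int)
    \<comment> \<open>Divisibility enters here: the value at \<open>x\<close> has to be a
      \<open>d\<close>-th root of the value \<open>c0\<close> already assigned to the
      \<open>d\<close>-th power of \<open>x\<close>.\<close>
    obtain a where a: "a \<in> carrier A" "a [^]\<^bsub>A\<^esub> int d = c0"
      using div d(1) carr(2)[OF c0] unfolding divisible_def by (metis int_pow_int)
    have "c = a [^]\<^bsub>A\<^esub> n" if nc: "(x [^]\<^bsub>E\<^esub> n, c) \<in> S" for n :: int and c
    proof -
      \<comment> \<open>Division with remainder by \<open>d\<close>: the power of \<open>x\<close>
        with exponent \<open>r\<close> is again in the domain, so minimality of \<open>d\<close>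
        leaves only \<open>r = 0\<close>.\<close>
      define q where "q = n div int d"
      define r where "r = nat (n mod int d)"
      have r: "n = int d * q + int r" "r < d"
        using d(1) unfolding q_def r_def by (auto simp: nat_less_iff)
      have c: "c \<in> carrier A" using carr[OF nc] by simp
      have "(x [^]\<^bsub>E\<^esub> int d) [^]\<^bsub>E\<^esub> (- q) = x [^]\<^bsub>E\<^esub> (- (int d * q))"
        "c0 [^]\<^bsub>A\<^esub> (- q) = a [^]\<^bsub>A\<^esub> (- (int d * q))"
        using E.int_pow_pow[OF x, of "int d" "- q"] A.int_pow_pow[OF a(1), of "int d" "- q"] a(2)
        by simp_all
      with mul[OF nc pow[OF c0, of "- q"]]
      have "(x [^]\<^bsub>E\<^esub> n \<otimes>\<^bsub>E\<^esub> x [^]\<^bsub>E\<^esub> (- (int d * q)), c \<otimes>\<^bsub>A\<^esub> a [^]\<^bsub>A\<^esub> (- (int d * q))) \<in> S"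
        by metis
      moreover have "x [^]\<^bsub>E\<^esub> n \<otimes>\<^bsub>E\<^esub> x [^]\<^bsub>E\<^esub> (- (int d * q)) = x [^]\<^bsub>E\<^esub> r"
        using x r(1) by (simp flip: E.int_pow_mult add: int_pow_int)
      ultimately have rS: "(x [^]\<^bsub>E\<^esub> r, c \<otimes>\<^bsub>A\<^esub> a [^]\<^bsub>A\<^esub> (- (int d * q))) \<in> S" by simp
      have "r = 0"
        using not_less_Least[of r "\<lambda>n. 0 < n \<and> (\<exists>c. (x [^]\<^bsub>E\<^esub> n, c) \<in> S)", folded d_def, OF r(2)] rS
        by auto
      with rS have "c \<otimes>\<^bsub>A\<^esub> inv\<^bsub>A\<^esub> (a [^]\<^bsub>A\<^esub> (int d * q)) = \<one>\<^bsub>A\<^esub>"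
        using func a(1) by (simp add: A.int_pow_neg)
      then show ?thesis
        using r(1) \<open>r = 0\<close> a(1) c A.inv_solve_right[of "\<one>\<^bsub>A\<^esub>" c "a [^]\<^bsub>A\<^esub> (int d * q)"] by simp
    qed
    with a(1) show ?thesis using that by blast
  qed
  let ?S' = "{s \<otimes>\<^bsub>E \<times>\<times> A\<^esub> (x, a) [^]\<^bsub>E \<times>\<times> A\<^esub> (n::int) | s n. s \<in> S}"
  have "subgroup ?S' (E \<times>\<times> A)"
    using x a by (intro subgroup_insert_multiples P.comm_group_axioms S) simp
  moreover have "S \<subseteq> ?S'"
  proof
    fix s assume "s \<in> S"
    moreover have "s = s \<otimes>\<^bsub>E \<times>\<times> A\<^esub> (x, a) [^]\<^bsub>E \<times>\<times> A\<^esub> (0::int)"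
      using S.mem_carrier[OF \<open>s \<in> S\<close>] P.r_one[of s] by simp
    ultimately show "s \<in> ?S'" by blast
  qed
  moreover have "(x, a) \<in> ?S'"
  proof -
    have "(x, a) = (\<one>\<^bsub>E\<^esub>, \<one>\<^bsub>A\<^esub>) \<otimes>\<^bsub>E \<times>\<times> A\<^esub> (x, a) [^]\<^bsub>E \<times>\<times> A\<^esub> (1::int)"
      using x a DirProd_int_pow[OF E.is_group A.is_group x a] by simp
    then show ?thesis using S.one_closed by auto
  qed
  moreover have "b = \<one>\<^bsub>A\<^esub>" if b: "(\<one>\<^bsub>E\<^esub>, b) \<in> ?S'" for b
  proof -
    from b obtain y c n where s: "(y, c) \<in> S"
      and eq: "(\<one>\<^bsub>E\<^esub>, b) = (y, c) \<otimes>\<^bsub>E \<times>\<times> A\<^esub> (x, a) [^]\<^bsub>E \<times>\<times> A\<^esub> (n::int)" by auto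
    have eqs: "y \<otimes>\<^bsub>E\<^esub> x [^]\<^bsub>E\<^esub> n = \<one>\<^bsub>E\<^esub>" "b = c \<otimes>\<^bsub>A\<^esub> a [^]\<^bsub>A\<^esub> n"
      using eq DirProd_int_pow[OF E.is_group A.is_group x a] by simp_all
    \<comment> \<open>A pair over the unit can only arise when \<open>y\<close> is itself a power of
      \<open>x\<close>, and there \<open>a_pow\<close> has already fixed the value
      \<open>c\<close>.\<close>
    have "y = x [^]\<^bsub>E\<^esub> (- n)"
      using E.inv_equality[OF eqs(1)] x carr[OF s] by (simp add: E.int_pow_neg)
    then have "c = a [^]\<^bsub>A\<^esub> (- n)" using s a_pow by blast
    then show ?thesis using eqs(2) a by (simp add: A.int_pow_neg)
  qed
  ultimately show ?thesis by blast
qed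

text \<open>For graphs, extension of homomorphisms is inclusion of sets, so Zorn's lemma applies to
  sets of pairs. A maximal graph is defined everywhere, as otherwise
  \<open>divisible_extension_step\<close> would enlarge it.\<close>

lemma divisible_extension:
  assumes E: "comm_group E" and A: "comm_group A" and div: "divisible A"
    and R: "subgroup R (E \<times>\<times> A)" and func: "\<And>a. (\<one>\<^bsub>E\<^esub>, a) \<in> R \<Longrightarrow> a = \<one>\<^bsub>A\<^esub>"
  shows "\<exists>f\<in>hom E A. \<forall>(x, a)\<in>R. f x = a"
proof -
  interpret E: comm_group E by fact
  interpret A: comm_group A by fact
  interpret P: comm_group "E \<times>\<times> A" using E A by (rule DirProd_comm_group)
  let ?F = "{S. subgroup S (E \<times>\<times> A) \<and> R \<subseteq> S \<and> (\<forall>a. (\<one>\<^bsub>E\<^esub>, a) \<in> S \<longrightarrow> a = \<one>\<^bsub>A\<^esub>)}"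
  have "\<exists>M\<in>?F. \<forall>X\<in>?F. M \<subseteq> X \<longrightarrow> X = M"
  proof (rule subset_Zorn_nonempty)
    show "?F \<noteq> {}" using R func by blast
  next
    fix C assume ne: "C \<noteq> {}" and ch: "subset.chain ?F C"
    have CF: "S \<in> ?F" if "S \<in> C" for S using ch that unfolding subset.chain_def by blast
    have "subgroup (\<Union>C) (E \<times>\<times> A)"
    proof (rule P.subgroupI)
      show "\<Union>C \<subseteq> carrier (E \<times>\<times> A)" using CF subgroup.subset by blast
      show "\<Union>C \<noteq> {}" using ne CF subgroup.one_closed by blast
      show "inv\<^bsub>E \<times>\<times> A\<^esub> u \<in> \<Union>C" if "u \<in> \<Union>C" for u
        using that CF subgroup.m_inv_closed by fast
      show "u \<otimes>\<^bsub>E \<times>\<times> A\<^esub> v \<in> \<Union>C" if uv: "u \<in> \<Union>C" "v \<in> \<Union>C" for u v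
      proof -
        obtain S T where ST: "S \<in> C" "T \<in> C" "u \<in> S" "v \<in> T" using uv by blast
        then have "S \<subseteq> T \<or> T \<subseteq> S" using ch unfolding subset.chain_def by blast
        then obtain U where "U \<in> C" "u \<in> U" "v \<in> U" using ST by blast
        then show ?thesis using CF subgroup.m_closed by fast
      qed
    qed
    then show "\<Union>C \<in> ?F" using ne CF by blast
  qed
  then obtain M where M: "M \<in> ?F" and max: "\<forall>X\<in>?F. M \<subseteq> X \<longrightarrow> X = M" by (rule bexE)
  from M have M_subgroup: "subgroup M (E \<times>\<times> A)" and RM: "R \<subseteq> M"
    and M_func: "\<And>a. (\<one>\<^bsub>E\<^esub>, a) \<in> M \<Longrightarrow> a = \<one>\<^bsub>A\<^esub>" by simp_all
  interpret M: subgroup M "E \<times>\<times> A" by (rule M_subgroup)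
  have carr: "y \<in> carrier E" "b \<in> carrier A" if "(y, b) \<in> M" for y b
    using M.mem_carrier[OF that] by auto
  have total: "\<exists>a. (x, a) \<in> M" if x: "x \<in> carrier E" for x
  proof -
    obtain S' a where S': "subgroup S' (E \<times>\<times> A)" "M \<subseteq> S'" "(x, a) \<in> S'"
      "\<forall>a. (\<one>\<^bsub>E\<^esub>, a) \<in> S' \<longrightarrow> a = \<one>\<^bsub>A\<^esub>"
      using divisible_extension_step[OF E A div M_subgroup M_func x] by blast
    have "S' \<in> ?F" using S' RM by simp
    with max S'(2) have "S' = M" by simp
    then show ?thesis using S'(3) by blast
  qed
  \<comment> \<open>The quotient of two pairs over the same \<open>x\<close> lies over the unit of
    \<open>E\<close>.\<close>
  have uniq: "a = b" if ab: "(x, a) \<in> M" "(x, b) \<in> M" for x a b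
  proof -
    have "(x \<otimes>\<^bsub>E\<^esub> inv\<^bsub>E\<^esub> x, a \<otimes>\<^bsub>A\<^esub> inv\<^bsub>A\<^esub> b) \<in> M"
      using M.m_closed[OF ab(1) M.m_inv_closed[OF ab(2)]] carr[OF ab(2)]
      by (simp add: inv_DirProd[OF E.is_group A.is_group])
    then have "a \<otimes>\<^bsub>A\<^esub> inv\<^bsub>A\<^esub> b = \<one>\<^bsub>A\<^esub>" using M_func carr[OF ab(1)] by simp
    then show ?thesis using carr[OF ab(1)] carr[OF ab(2)] A.inv_solve_right[of "\<one>\<^bsub>A\<^esub>" a b] by simp
  qed
  define f where "f x = (THE a. (x, a) \<in> M)" for x
  have f: "f x = a" if "(x, a) \<in> M" for x a
    unfolding f_def using that uniq by blast
  have "f \<in> hom E A"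
  proof (rule homI)
    fix x assume "x \<in> carrier E"
    then obtain a where "(x, a) \<in> M" using total by blast
    then show "f x \<in> carrier A" using f carr by blast
  next
    fix x y assume "x \<in> carrier E" "y \<in> carrier E"
    then obtain a b where ab: "(x, a) \<in> M" "(y, b) \<in> M" using total by blast
    then show "f (x \<otimes>\<^bsub>E\<^esub> y) = f x \<otimes>\<^bsub>A\<^esub> f y"
      using M.m_closed[OF ab] f by simp
  qed
  then show ?thesis using RM f by blast
qed

section \<open>Cocycles and extensions\<close>

text \<open>The form without inverses is the one that associativity in the extension group calls
  for.\<close>

lemma Z2_cocycle:
  assumes "group G" "comm_group A" "\<phi> \<in> Z2 G A"
    and f: "f \<in> carrier G" and g: "g \<in> carrier G" and h: "h \<in> carrier G"
  shows "\<phi> (g, h) \<otimes>\<^bsub>A\<^esub> \<phi> (f, g \<otimes>\<^bsub>G\<^esub> h) = \<phi> (f, g) \<otimes>\<^bsub>A\<^esub> \<phi> (f \<otimes>\<^bsub>G\<^esub> g, h)"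
proof -
  interpret G: group G by fact
  interpret A: comm_group A by fact
  have c: "\<phi> (x, y) \<in> carrier A" if "x \<in> carrier G" "y \<in> carrier G" for x y
    using assms(3) that unfolding Z2_def cochain_group_def by auto
  have "\<phi> (g, h) \<otimes>\<^bsub>A\<^esub> inv\<^bsub>A\<^esub> \<phi> (f \<otimes>\<^bsub>G\<^esub> g, h) \<otimes>\<^bsub>A\<^esub> \<phi> (f, g \<otimes>\<^bsub>G\<^esub> h) \<otimes>\<^bsub>A\<^esub> inv\<^bsub>A\<^esub> \<phi> (f, g) = \<one>\<^bsub>A\<^esub>"
    using assms(3) f g h unfolding Z2_def by blast
  moreover have "\<phi> (g, h) \<otimes>\<^bsub>A\<^esub> inv\<^bsub>A\<^esub> \<phi> (f \<otimes>\<^bsub>G\<^esub> g, h) \<otimes>\<^bsub>A\<^esub> \<phi> (f, g \<otimes>\<^bsub>G\<^esub> h) \<otimes>\<^bsub>A\<^esub> inv\<^bsub>A\<^esub> \<phi> (f, g) =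
      (\<phi> (g, h) \<otimes>\<^bsub>A\<^esub> \<phi> (f, g \<otimes>\<^bsub>G\<^esub> h)) \<otimes>\<^bsub>A\<^esub> inv\<^bsub>A\<^esub> (\<phi> (f, g) \<otimes>\<^bsub>A\<^esub> \<phi> (f \<otimes>\<^bsub>G\<^esub> g, h))"
    using f g h c by (simp add: A.inv_mult A.m_ac)
  ultimately show ?thesis
    using f g h c A.inv_solve_right[of "\<one>\<^bsub>A\<^esub>" "\<phi> (g, h) \<otimes>\<^bsub>A\<^esub> \<phi> (f, g \<otimes>\<^bsub>G\<^esub> h)" "\<phi> (f, g) \<otimes>\<^bsub>A\<^esub> \<phi> (f \<otimes>\<^bsub>G\<^esub> g, h)"]
    by simp
qed

lemma (in group) mult_inv_cancel:
  assumes "x \<in> carrier G" "y \<in> carrier G"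
  shows "x \<otimes> (inv x \<otimes> y) = y"
  using assms by (simp flip: m_assoc)

lemma (in comm_group) mult_mult_inv_cancel:
  assumes "x \<in> carrier G" "y \<in> carrier G"
  shows "x \<otimes> (y \<otimes> inv x) = y"
  using assms m_lcomm[of x y "inv x"] by simp

lemma B2_subset_Z2:
  assumes "group G" "comm_group A"
  shows "B2 G A \<subseteq> Z2 G A"
proof
  interpret G: group G by fact
  interpret A: comm_group A by fact
  fix \<phi> assume "\<phi> \<in> B2 G A"
  then obtain \<beta> where \<phi>: "\<phi> \<in> carrier (cochain_group G A)" and \<beta>: "\<beta> \<in> carrier G \<rightarrow> carrier A"
    and eq: "\<And>f g. f \<in> carrier G \<Longrightarrow> g \<in> carrier G \<Longrightarrow>
      \<phi> (f, g) = \<beta> g \<otimes>\<^bsub>A\<^esub> inv\<^bsub>A\<^esub> \<beta> (f \<otimes>\<^bsub>G\<^esub> g) \<otimes>\<^bsub>A\<^esub> \<beta> f"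
    unfolding B2_def by blast
  have group_identity: "(z \<otimes>\<^bsub>A\<^esub> inv\<^bsub>A\<^esub> yz \<otimes>\<^bsub>A\<^esub> y) \<otimes>\<^bsub>A\<^esub> inv\<^bsub>A\<^esub> (z \<otimes>\<^bsub>A\<^esub> inv\<^bsub>A\<^esub> xyz \<otimes>\<^bsub>A\<^esub> xy)
      \<otimes>\<^bsub>A\<^esub> (yz \<otimes>\<^bsub>A\<^esub> inv\<^bsub>A\<^esub> xyz \<otimes>\<^bsub>A\<^esub> x) \<otimes>\<^bsub>A\<^esub> inv\<^bsub>A\<^esub> (y \<otimes>\<^bsub>A\<^esub> inv\<^bsub>A\<^esub> xy \<otimes>\<^bsub>A\<^esub> x) = \<one>\<^bsub>A\<^esub>"
    if "x \<in> carrier A" "y \<in> carrier A" "z \<in> carrier A"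
      "xy \<in> carrier A" "yz \<in> carrier A" "xyz \<in> carrier A" for x y z xy yz xyz
  proof -
    \<comment> \<open>Each of the six values of \<beta> occurs once as itself and once inverted, so
      up to order the product is \<open>?p\<close> times its inverse. The cancellation rules are
      switched off to keep this fact from collapsing before it is sorted.\<close>
    let ?p = "x \<otimes>\<^bsub>A\<^esub> xy \<otimes>\<^bsub>A\<^esub> xyz \<otimes>\<^bsub>A\<^esub> y \<otimes>\<^bsub>A\<^esub> yz \<otimes>\<^bsub>A\<^esub> z"
    have "?p \<otimes>\<^bsub>A\<^esub> inv\<^bsub>A\<^esub> ?p = \<one>\<^bsub>A\<^esub>" using that by simp
    then show ?thesis using that by (simp add: A.inv_mult A.m_ac del: A.r_inv A.Units_r_inv)
  qed
  show "\<phi> \<in> Z2 G A"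
    unfolding Z2_def using \<phi> \<beta> by (auto simp: eq G.m_assoc Pi_iff intro!: group_identity)
qed

text \<open>The central extension with factor set \<phi>. Its unit is not the pair of units because
  \<phi> need not be normalised.\<close>

definition cocycle_extension ::
    "('g, 'm) monoid_scheme \<Rightarrow> ('a, 'n) monoid_scheme \<Rightarrow> ('g \<times> 'g \<Rightarrow> 'a) \<Rightarrow> ('a \<times> 'g) monoid" where
  "cocycle_extension G A \<phi> =
     \<lparr>carrier = carrier A \<times> carrier G,
      monoid.mult = (\<lambda>(a, g) (b, h). (a \<otimes>\<^bsub>A\<^esub> b \<otimes>\<^bsub>A\<^esub> \<phi> (g, h), g \<otimes>\<^bsub>G\<^esub> h)),
      one = (inv\<^bsub>A\<^esub> \<phi> (\<one>\<^bsub>G\<^esub>, \<one>\<^bsub>G\<^esub>), \<one>\<^bsub>G\<^esub>)\<rparr>"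

lemma cocycle_extension_simps [simp]:
  "carrier (cocycle_extension G A \<phi>) = carrier A \<times> carrier G"
  "(a, g) \<otimes>\<^bsub>cocycle_extension G A \<phi>\<^esub> (b, h) = (a \<otimes>\<^bsub>A\<^esub> b \<otimes>\<^bsub>A\<^esub> \<phi> (g, h), g \<otimes>\<^bsub>G\<^esub> h)"
  "\<one>\<^bsub>cocycle_extension G A \<phi>\<^esub> = (inv\<^bsub>A\<^esub> \<phi> (\<one>\<^bsub>G\<^esub>, \<one>\<^bsub>G\<^esub>), \<one>\<^bsub>G\<^esub>)"
  by (simp_all add: cocycle_extension_def)

context
  fixes G :: "('g, 'm) monoid_scheme" and A :: "('a, 'n) monoid_scheme" and \<phi>
  assumes G: "group G" and A: "comm_group A" and \<phi>: "\<phi> \<in> Z2 G A"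
begin

interpretation G: group G by (rule G)
interpretation A: comm_group A by (rule A)

lemma Z2_closed: "g \<in> carrier G \<Longrightarrow> h \<in> carrier G \<Longrightarrow> \<phi> (g, h) \<in> carrier A"
  using \<phi> unfolding Z2_def cochain_group_def by auto

text \<open>The cocycle identity at (1, 1, g). It is what makes the corrected unit of the extension
  group act trivially from the left.\<close>

lemma Z2_one_left: 
  assumes "g \<in> carrier G"
  shows "\<phi> (\<one>\<^bsub>G\<^esub>, g) = \<phi> (\<one>\<^bsub>G\<^esub>, \<one>\<^bsub>G\<^esub>)"
  using Z2_cocycle[OF G A \<phi> G.one_closed G.one_closed assms] Z2_closed assms by simp

lemma group_cocycle_extension: "group (cocycle_extension G A \<phi>)"
proof (rule groupI)
  let ?E = "cocycle_extension G A \<phi>"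
  show "\<one>\<^bsub>?E\<^esub> \<in> carrier ?E" using Z2_closed by simp
  show "u \<otimes>\<^bsub>?E\<^esub> v \<in> carrier ?E" if "u \<in> carrier ?E" "v \<in> carrier ?E" for u v
    using that Z2_closed by (cases u; cases v) simp
  show "u \<otimes>\<^bsub>?E\<^esub> v \<otimes>\<^bsub>?E\<^esub> w = u \<otimes>\<^bsub>?E\<^esub> (v \<otimes>\<^bsub>?E\<^esub> w)"
    if uvw: "u \<in> carrier ?E" "v \<in> carrier ?E" "w \<in> carrier ?E" for u v w
  proof -
    obtain a f b g c h where u: "u = (a, f)" "v = (b, g)" "w = (c, h)"
      by (cases u, cases v, cases w)
    have car: "a \<in> carrier A" "b \<in> carrier A" "c \<in> carrier A"
      "f \<in> carrier G" "g \<in> carrier G" "h \<in> carrier G" using uvw u by auto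
    \<comment> \<open>Associativity amounts to the cocycle identity once the coefficients are moved
      to the front.\<close>
    have "a \<otimes>\<^bsub>A\<^esub> b \<otimes>\<^bsub>A\<^esub> \<phi> (f, g) \<otimes>\<^bsub>A\<^esub> c \<otimes>\<^bsub>A\<^esub> \<phi> (f \<otimes>\<^bsub>G\<^esub> g, h) =
        (a \<otimes>\<^bsub>A\<^esub> b \<otimes>\<^bsub>A\<^esub> c) \<otimes>\<^bsub>A\<^esub> (\<phi> (f, g) \<otimes>\<^bsub>A\<^esub> \<phi> (f \<otimes>\<^bsub>G\<^esub> g, h))"
      using car Z2_closed by (simp add: A.m_ac)
    also have "\<dots> = (a \<otimes>\<^bsub>A\<^esub> b \<otimes>\<^bsub>A\<^esub> c) \<otimes>\<^bsub>A\<^esub> (\<phi> (g, h) \<otimes>\<^bsub>A\<^esub> \<phi> (f, g \<otimes>\<^bsub>G\<^esub> h))"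
      using Z2_cocycle[OF G A \<phi> car(4-6)] by simp
    also have "\<dots> = a \<otimes>\<^bsub>A\<^esub> (b \<otimes>\<^bsub>A\<^esub> c \<otimes>\<^bsub>A\<^esub> \<phi> (g, h)) \<otimes>\<^bsub>A\<^esub> \<phi> (f, g \<otimes>\<^bsub>G\<^esub> h)"
      using car Z2_closed by (simp add: A.m_ac)
    finally show ?thesis using car unfolding u by (simp add: G.m_assoc)
  qed
  show "\<one>\<^bsub>?E\<^esub> \<otimes>\<^bsub>?E\<^esub> u = u" if "u \<in> carrier ?E" for u
    using that Z2_closed Z2_one_left[of "snd u"] by (cases u) (simp add: A.m_ac A.mult_inv_cancel)
  show "\<exists>v\<in>carrier ?E. v \<otimes>\<^bsub>?E\<^esub> u = \<one>\<^bsub>?E\<^esub>" if uE: "u \<in> carrier ?E" for u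
  proof -
    obtain a g where u: "u = (a, g)" "a \<in> carrier A" "g \<in> carrier G"
      using uE by (cases u) simp
    \<comment> \<open>The first coordinate is solved from the requirement that its product with
      \<open>a\<close> and the cocycle value at the pair of \<open>inv g\<close> and
      \<open>g\<close> be the first coordinate of the unit.\<close>
    let ?v = "(inv\<^bsub>A\<^esub> a \<otimes>\<^bsub>A\<^esub> (inv\<^bsub>A\<^esub> \<phi> (inv\<^bsub>G\<^esub> g, g) \<otimes>\<^bsub>A\<^esub> inv\<^bsub>A\<^esub> \<phi> (\<one>\<^bsub>G\<^esub>, \<one>\<^bsub>G\<^esub>)), inv\<^bsub>G\<^esub> g)"
    have "?v \<otimes>\<^bsub>?E\<^esub> u = \<one>\<^bsub>?E\<^esub>"
      using u Z2_closed by (simp add: A.m_ac A.mult_inv_cancel A.mult_mult_inv_cancel)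
    moreover have "?v \<in> carrier ?E" using u Z2_closed by simp
    ultimately show ?thesis by blast
  qed
qed

lemma comm_group_cocycle_extension:
  assumes "comm_group G" "symmetric_on G \<phi>"
  shows "comm_group (cocycle_extension G A \<phi>)"
proof -
  interpret G: comm_group G by fact
  show ?thesis
    using assms(2) Z2_closed unfolding symmetric_on_def
    by (intro group.group_comm_groupI group_cocycle_extension) (auto simp: A.m_ac G.m_comm)
qed

text \<open>A retraction of the extension group onto \<open>A\<close>, which exists since \<open>A\<close> is divisible, restricts
  on the section \<open>g \<mapsto> (\<one>, g)\<close> to a cochain with coboundary \<open>\<phi>\<close>.\<close>

lemma symmetric_Z2_imp_B2:
  assumes "comm_group G" "symmetric_on G \<phi>" "divisible A"
  shows "\<phi> \<in> B2 G A"
proof -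
  let ?E = "cocycle_extension G A \<phi>" and ?c = "inv\<^bsub>A\<^esub> \<phi> (\<one>\<^bsub>G\<^esub>, \<one>\<^bsub>G\<^esub>)"
  have E: "comm_group ?E" by (rule comm_group_cocycle_extension) fact+
  interpret E: comm_group ?E by (rule E)
  interpret P: comm_group "?E \<times>\<times> A" using E A by (rule DirProd_comm_group)
  \<comment> \<open>The embedding of \<open>A\<close> into the extension group, shifted by
    \<open>?c\<close> so that it preserves units. Its image is paired with \<open>a\<close>, so the
    range of \<open>?\<iota>\<close> is the graph of the inverse of the embedding, and extending
    this graph yields a retraction.\<close>
  let ?\<iota> = "\<lambda>a. ((a \<otimes>\<^bsub>A\<^esub> ?c, \<one>\<^bsub>G\<^esub>), a)"
  have c: "?c \<in> carrier A" using Z2_closed by simp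
  have \<iota>: "?\<iota> \<in> hom A (?E \<times>\<times> A)"
    using Z2_closed by (auto intro!: homI simp: A.m_ac A.mult_inv_cancel)
  have "subgroup (?\<iota> ` carrier A) (?E \<times>\<times> A)"
    using \<iota> group_hom.img_is_subgroup[of A "?E \<times>\<times> A" ?\<iota>] A.is_group P.is_group
    by (simp add: group_hom_def group_hom_axioms_def)
  moreover have "a = \<one>\<^bsub>A\<^esub>" if "(\<one>\<^bsub>?E\<^esub>, a) \<in> ?\<iota> ` carrier A" for a
    using that c by (auto simp: A.l_cancel_one)
  ultimately have "\<exists>r\<in>hom ?E A. \<forall>(u, a)\<in>?\<iota> ` carrier A. r u = a"
    by (intro divisible_extension E A assms(3))
  then obtain r where r: "r \<in> hom ?E A" and r\<iota>: "\<And>a. a \<in> carrier A \<Longrightarrow> r (a \<otimes>\<^bsub>A\<^esub> ?c, \<one>\<^bsub>G\<^esub>) = a"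
    by auto
  define \<beta> where "\<beta> g = r (\<one>\<^bsub>A\<^esub>, g)" for g
  have \<beta>: "\<beta> g \<in> carrier A" if "g \<in> carrier G" for g
    using hom_in_carrier[OF r, of "(\<one>\<^bsub>A\<^esub>, g)"] that unfolding \<beta>_def by simp
  have "\<phi> (f, g) = \<beta> g \<otimes>\<^bsub>A\<^esub> inv\<^bsub>A\<^esub> \<beta> (f \<otimes>\<^bsub>G\<^esub> g) \<otimes>\<^bsub>A\<^esub> \<beta> f" if fg: "f \<in> carrier G" "g \<in> carrier G" for f g
  proof -
    have \<phi>c: "\<phi> (f, g) \<in> carrier A" using Z2_closed fg by simp
    \<comment> \<open>The product of two lifts is the lift of the product times the embedded value
      of \<phi>; the factor \<open>?c\<close> cancels against the value of \<phi> at the unit and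
      the product of \<open>f\<close> and \<open>g\<close>. Applying \<open>r\<close> gives the
      coboundary equation.\<close>
    have prod: "(\<one>\<^bsub>A\<^esub>, f) \<otimes>\<^bsub>?E\<^esub> (\<one>\<^bsub>A\<^esub>, g) =
        (\<phi> (f, g) \<otimes>\<^bsub>A\<^esub> ?c, \<one>\<^bsub>G\<^esub>) \<otimes>\<^bsub>?E\<^esub> (\<one>\<^bsub>A\<^esub>, f \<otimes>\<^bsub>G\<^esub> g)"
      using fg Z2_closed Z2_one_left[of "f \<otimes>\<^bsub>G\<^esub> g"] by (simp add: A.m_assoc)
    have "\<beta> f \<otimes>\<^bsub>A\<^esub> \<beta> g = \<phi> (f, g) \<otimes>\<^bsub>A\<^esub> \<beta> (f \<otimes>\<^bsub>G\<^esub> g)"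
      unfolding \<beta>_def using fg \<phi>c c r\<iota>[OF \<phi>c] arg_cong[OF prod, of r]
      by (simp add: hom_mult[OF r] del: cocycle_extension_simps(2))
    then have "\<phi> (f, g) = \<beta> f \<otimes>\<^bsub>A\<^esub> \<beta> g \<otimes>\<^bsub>A\<^esub> inv\<^bsub>A\<^esub> \<beta> (f \<otimes>\<^bsub>G\<^esub> g)"
      using fg \<beta> \<phi>c A.inv_solve_right[of "\<phi> (f, g)" "\<beta> f \<otimes>\<^bsub>A\<^esub> \<beta> g" "\<beta> (f \<otimes>\<^bsub>G\<^esub> g)"] by simp
    then show ?thesis using fg \<beta> by (simp add: A.m_ac)
  qed
  then show ?thesis using \<phi> \<beta> unfolding B2_def Z2_def by blast
qed

text \<open>The lifts of powers of one element to the extension group differ from the powers of its lift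
  by central elements, and so commute.\<close>

lemma Z2_powers_commute:
  fixes m n :: int
  assumes x: "x \<in> carrier G"
  shows "\<phi> (x [^]\<^bsub>G\<^esub> m, x [^]\<^bsub>G\<^esub> n) = \<phi> (x [^]\<^bsub>G\<^esub> n, x [^]\<^bsub>G\<^esub> m)"
proof -
  let ?E = "cocycle_extension G A \<phi>"
  interpret E: group ?E by (rule group_cocycle_extension)
  have snd: "snd \<in> hom ?E G" by (auto simp: hom_def)
  have e: "(\<one>\<^bsub>A\<^esub>, x) \<in> carrier ?E" using x by simp
  \<comment> \<open>Only the projection to \<open>G\<close> of a power of the lift has to be known:
    the unknown coefficients \<open>a\<close> and \<open>b\<close> cancel at the end.\<close>
  have "\<exists>a\<in>carrier A. (\<one>\<^bsub>A\<^esub>, x) [^]\<^bsub>?E\<^esub> k = (a, x [^]\<^bsub>G\<^esub> k)" for k :: int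
    using hom_int_pow[OF snd e E.is_group G, of k] E.int_pow_closed[OF e, of k]
    by (cases "(\<one>\<^bsub>A\<^esub>, x) [^]\<^bsub>?E\<^esub> k") auto
  then obtain a b where a: "a \<in> carrier A" "(\<one>\<^bsub>A\<^esub>, x) [^]\<^bsub>?E\<^esub> m = (a, x [^]\<^bsub>G\<^esub> m)"
    and b: "b \<in> carrier A" "(\<one>\<^bsub>A\<^esub>, x) [^]\<^bsub>?E\<^esub> n = (b, x [^]\<^bsub>G\<^esub> n)" by meson
  have "(a, x [^]\<^bsub>G\<^esub> m) \<otimes>\<^bsub>?E\<^esub> (b, x [^]\<^bsub>G\<^esub> n) = (b, x [^]\<^bsub>G\<^esub> n) \<otimes>\<^bsub>?E\<^esub> (a, x [^]\<^bsub>G\<^esub> m)"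
    using E.int_pow_mult[OF e, of m n] E.int_pow_mult[OF e, of n m] unfolding a(2) b(2)
    by (simp only: add.commute)
  then have "a \<otimes>\<^bsub>A\<^esub> b \<otimes>\<^bsub>A\<^esub> \<phi> (x [^]\<^bsub>G\<^esub> m, x [^]\<^bsub>G\<^esub> n) = b \<otimes>\<^bsub>A\<^esub> a \<otimes>\<^bsub>A\<^esub> \<phi> (x [^]\<^bsub>G\<^esub> n, x [^]\<^bsub>G\<^esub> m)"
    by simp
  then show ?thesis using a b x Z2_closed A.m_comm[of a b] by simp
qed

end

section \<open>Cohomology as a quotient of groups of cocycles\<close>

lemma (in group) trivial_group_Mod_carrier: "trivial_group (G Mod carrier G)"
proof -
  have "carrier (G Mod carrier G) = {carrier G}"
    using coset_join2[OF _ subgroup_self] one_closed unfolding carrier_FactGroup by fast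
  then show ?thesis
    using normal.factorgroup_is_group[OF normal_self] unfolding trivial_group_def by simp
qed

context
  fixes G :: "('g, 'm) monoid_scheme" and A :: "('a, 'n) monoid_scheme"
  assumes G: "group G" and A: "comm_group A"
begin

interpretation G: group G by (rule G)
interpretation A: comm_group A by (rule A)

lemma group_cochain_group: "group (cochain_group G A)"
  unfolding cochain_group_def by simp

lemma Z2_subgroup: "subgroup (Z2 G A) (cochain_group G A)"
proof -
  interpret C: group "cochain_group G A" by (rule group_cochain_group)
  note car [simp] = Z2_closed[OF G A]
  have C: "\<phi> \<in> carrier (cochain_group G A) \<longleftrightarrow> \<phi> \<in> carrier G \<times> carrier G \<rightarrow>\<^sub>E carrier A" for \<phi>
    unfolding cochain_group_def by simp
  have mult: "(\<phi> \<otimes>\<^bsub>cochain_group G A\<^esub> \<psi>) (g, h) = \<phi> (g, h) \<otimes>\<^bsub>A\<^esub> \<psi> (g, h)"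
    if "g \<in> carrier G" "h \<in> carrier G" for \<phi> \<psi> g h
    using that unfolding cochain_group_def by simp
  have inv: "(inv\<^bsub>cochain_group G A\<^esub> \<phi>) (g, h) = inv\<^bsub>A\<^esub> \<phi> (g, h)"
    if "g \<in> carrier G" "h \<in> carrier G" "\<phi> \<in> carrier (cochain_group G A)" for \<phi> g h
    using that unfolding cochain_group_def by (subst inv_product_group) auto
  show ?thesis
  proof (rule C.subgroupI)
    show "Z2 G A \<subseteq> carrier (cochain_group G A)" unfolding Z2_def by blast
    have "\<one>\<^bsub>cochain_group G A\<^esub> \<in> Z2 G A"
      unfolding Z2_def using C.one_closed by (simp add: cochain_group_def)
    then show "Z2 G A \<noteq> {}" by blast
  next
    fix \<phi> assume \<phi>: "\<phi> \<in> Z2 G A"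
    \<comment> \<open>The inverse of the cocycle equation, with double inverses left in place to
      match the condition for the inverse cochain.\<close>
    have "inv\<^bsub>A\<^esub> a \<otimes>\<^bsub>A\<^esub> inv\<^bsub>A\<^esub> (inv\<^bsub>A\<^esub> b) \<otimes>\<^bsub>A\<^esub> inv\<^bsub>A\<^esub> c \<otimes>\<^bsub>A\<^esub> inv\<^bsub>A\<^esub> (inv\<^bsub>A\<^esub> d) = \<one>\<^bsub>A\<^esub>"
      if "a \<otimes>\<^bsub>A\<^esub> inv\<^bsub>A\<^esub> b \<otimes>\<^bsub>A\<^esub> c \<otimes>\<^bsub>A\<^esub> inv\<^bsub>A\<^esub> d = \<one>\<^bsub>A\<^esub>"
        "a \<in> carrier A" "b \<in> carrier A" "c \<in> carrier A" "d \<in> carrier A" for a b c d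
      using arg_cong[OF that(1), of "m_inv A"] that(2-) by (simp add: A.inv_mult A.m_ac)
    with \<phi> show "inv\<^bsub>cochain_group G A\<^esub> \<phi> \<in> Z2 G A"
      unfolding Z2_def using Z2_closed[OF G A \<phi>] by (auto simp: inv simp del: A.inv_inv)
  next
    fix \<phi> \<psi> assume \<phi>: "\<phi> \<in> Z2 G A" and \<psi>: "\<psi> \<in> Z2 G A"
    have "(a \<otimes>\<^bsub>A\<^esub> a') \<otimes>\<^bsub>A\<^esub> inv\<^bsub>A\<^esub> (b \<otimes>\<^bsub>A\<^esub> b') \<otimes>\<^bsub>A\<^esub> (c \<otimes>\<^bsub>A\<^esub> c') \<otimes>\<^bsub>A\<^esub> inv\<^bsub>A\<^esub> (d \<otimes>\<^bsub>A\<^esub> d') = \<one>\<^bsub>A\<^esub>"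
      if "a \<otimes>\<^bsub>A\<^esub> inv\<^bsub>A\<^esub> b \<otimes>\<^bsub>A\<^esub> c \<otimes>\<^bsub>A\<^esub> inv\<^bsub>A\<^esub> d = \<one>\<^bsub>A\<^esub>" "a' \<otimes>\<^bsub>A\<^esub> inv\<^bsub>A\<^esub> b' \<otimes>\<^bsub>A\<^esub> c' \<otimes>\<^bsub>A\<^esub> inv\<^bsub>A\<^esub> d' = \<one>\<^bsub>A\<^esub>"
        "a \<in> carrier A" "b \<in> carrier A" "c \<in> carrier A" "d \<in> carrier A"
        "a' \<in> carrier A" "b' \<in> carrier A" "c' \<in> carrier A" "d' \<in> carrier A" for a b c d a' b' c' d'
      using arg_cong2[OF that(1,2), of "monoid.mult A"] that(3-) by (simp add: A.inv_mult A.m_ac)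
    with \<phi> \<psi> show "\<phi> \<otimes>\<^bsub>cochain_group G A\<^esub> \<psi> \<in> Z2 G A"
      unfolding Z2_def using Z2_closed[OF G A \<phi>] Z2_closed[OF G A \<psi>] by (auto simp: mult)
  qed
qed

lemma Z2_sym_subgroup: "subgroup (Z2_sym G A) (cochain_group G A)"
proof -
  interpret C: group "cochain_group G A" by (rule group_cochain_group)
  interpret Z: subgroup "Z2 G A" "cochain_group G A" by (rule Z2_subgroup)
  have sym_mult: "symmetric_on G (\<phi> \<otimes>\<^bsub>cochain_group G A\<^esub> \<psi>)"
    if "symmetric_on G \<phi>" "symmetric_on G \<psi>" for \<phi> \<psi>
    using that unfolding symmetric_on_def cochain_group_def by simp
  have sym_inv: "symmetric_on G (inv\<^bsub>cochain_group G A\<^esub> \<phi>)"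
    if "symmetric_on G \<phi>" "\<phi> \<in> carrier (cochain_group G A)" for \<phi>
    using that unfolding symmetric_on_def cochain_group_def by (subst inv_product_group) auto
  have "symmetric_on G \<one>\<^bsub>cochain_group G A\<^esub>"
    unfolding symmetric_on_def cochain_group_def by simp
  then show ?thesis
    unfolding Z2_sym_def using sym_mult sym_inv
    by (intro C.subgroupI) (auto intro: Z.m_closed Z.m_inv_closed Z.one_closed)
qed

text \<open>All symmetric cocycles are coboundaries, so the quotient is that of a group by its own
  carrier.\<close>

lemma trivial_H2_sym:
  assumes "comm_group G" "divisible A"
  shows "trivial_group (H2_sym G A)"
proof -
  have "B2_sym G A = Z2_sym G A"
    using B2_subset_Z2[OF G A] symmetric_Z2_imp_B2[OF G A _ assms(1) _ assms(2)]
    unfolding B2_sym_def Z2_sym_def by auto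
  then show ?thesis
    using group.trivial_group_Mod_carrier[OF subgroup.subgroup_is_group[OF Z2_sym_subgroup group_cochain_group]]
    unfolding H2_sym_def by simp
qed

end

text \<open>Reduces the rank one claims to the symmetric case; coboundaries inherit symmetry because
  they are cocycles.\<close>

lemma H2_eq_H2_sym:
  assumes "comm_group G" "comm_group A" "\<And>\<phi>. \<phi> \<in> Z2 G A \<Longrightarrow> symmetric_on G \<phi>"
  shows "H2 G A = H2_sym G A"
proof -
  interpret G: comm_group G by fact
  have "Z2_sym G A = Z2 G A" "B2_sym G A = B2 G A"
    using assms(3) B2_subset_Z2[OF G.is_group assms(2)] unfolding Z2_sym_def B2_sym_def by blast+
  then show ?thesis unfolding H2_def H2_sym_def by simp
qed

section \<open>The coefficient groups\<close>

lemma rat_add_simps [simp]: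
  "carrier rat_add = UNIV" "x \<otimes>\<^bsub>rat_add\<^esub> y = x + y" "\<one>\<^bsub>rat_add\<^esub> = 0"
  by (simp_all add: rat_add_def additive_group_def)

lemma comm_group_additive_group:
  assumes "0 \<in> S" "\<And>x y. x \<in> S \<Longrightarrow> y \<in> S \<Longrightarrow> x + y \<in> S" "\<And>x. x \<in> S \<Longrightarrow> - x \<in> S"
  shows "comm_group (additive_group S)"
  unfolding additive_group_def
  by (rule comm_groupI) (use assms in \<open>auto simp: add.assoc add.commute intro: bexI[of _ "- _"]\<close>)

lemma nat_pow_additive_group:
  fixes x :: "'a::{ab_group_add,semiring_1}"
  shows "x [^]\<^bsub>additive_group S\<^esub> (n::nat) = of_nat n * x"
  by (induction n) (simp_all add: additive_group_def nat_pow_def distrib_right add.commute)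

lemma comm_group_multiplicative_group:
  assumes "1 \<in> S" "0 \<notin> S" "\<And>x y. x \<in> S \<Longrightarrow> y \<in> S \<Longrightarrow> x * y \<in> S" "\<And>x. x \<in> S \<Longrightarrow> inverse x \<in> S"
  shows "comm_group (multiplicative_group S)"
  unfolding multiplicative_group_def
proof (rule comm_groupI)
  fix x assume "x \<in> carrier \<lparr>carrier = S, monoid.mult = (*), one = 1\<rparr>"
  then have "x \<in> S" "x \<noteq> 0" using assms(2) by auto
  then show "\<exists>y\<in>carrier \<lparr>carrier = S, monoid.mult = (*), one = 1\<rparr>.
      y \<otimes>\<^bsub>\<lparr>carrier = S, monoid.mult = (*), one = 1\<rparr>\<^esub> x = \<one>\<^bsub>\<lparr>carrier = S, monoid.mult = (*), one = 1\<rparr>\<^esub>"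
    using assms(4) by (intro bexI[of _ "inverse x"]) auto
qed (use assms in \<open>auto simp: mult.assoc mult.commute\<close>)

lemma nat_pow_multiplicative_group: "x [^]\<^bsub>multiplicative_group S\<^esub> (n::nat) = x ^ n"
  by (induction n) (simp_all add: multiplicative_group_def nat_pow_def mult.commute)

text \<open>Roots are demanded only up to a factor in \<open>N\<close>. This weaker condition is
  needed for Z[1/p], which is not divisible itself: 1 is not a multiple of a prime other than p
  there.\<close>

lemma divisible_Mod:
  assumes "N \<lhd> H"
    and div: "\<And>x n. x \<in> carrier H \<Longrightarrow> 0 < n \<Longrightarrow> \<exists>y\<in>carrier H. \<exists>z\<in>N. y [^]\<^bsub>H\<^esub> (n::nat) = z \<otimes>\<^bsub>H\<^esub> x"
  shows "divisible (H Mod N)"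
  unfolding divisible_def
proof (intro ballI allI impI)
  interpret N: normal N H by fact
  fix X and n :: nat assume "X \<in> carrier (H Mod N)" "0 < n"
  then obtain x where x: "x \<in> carrier H" "X = N #>\<^bsub>H\<^esub> x" unfolding carrier_FactGroup by blast
  obtain y z where y: "y \<in> carrier H" and z: "z \<in> N" "y [^]\<^bsub>H\<^esub> n = z \<otimes>\<^bsub>H\<^esub> x"
    using div[OF x(1) \<open>0 < n\<close>] by blast
  have "(N #>\<^bsub>H\<^esub> y) [^]\<^bsub>H Mod N\<^esub> n = N #>\<^bsub>H\<^esub> (y [^]\<^bsub>H\<^esub> n)"
    using hom_nat_pow[OF N.r_coset_hom_Mod y N.is_group N.factorgroup_is_group] by simp
  also have "\<dots> = X"
    unfolding x(2) z(2) using N.coset_mult_assoc[of N z x] N.rcos_const[OF N.is_group z(1)] z(1) x(1) N.subset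
    by force
  finally show "\<exists>Y\<in>carrier (H Mod N). Y [^]\<^bsub>H Mod N\<^esub> n = X"
    using y unfolding carrier_FactGroup by blast
qed

lemma subgroup_Ints_additive_group:
  assumes "\<int> \<subseteq> S" and "comm_group (additive_group (S :: 'a::ring_1 set))"
  shows "subgroup \<int> (additive_group S)"
proof -
  interpret S: comm_group "additive_group S" by fact
  have inv: "inv\<^bsub>additive_group S\<^esub> x = - x" if "x \<in> \<int>" for x
    using that assms(1) by (intro S.inv_equality) (auto simp: additive_group_def)
  show ?thesis
    by (rule S.subgroupI) (use assms(1) in \<open>auto simp: inv\<close>, auto simp: additive_group_def)
qed

lemma additive_group_UNIV: "comm_group (additive_group UNIV)"
  by (rule comm_group_additive_group) auto

lemma divisible_additive_group_UNIV: "divisible (additive_group (UNIV :: 'a::field_char_0 set))"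
  unfolding divisible_def nat_pow_additive_group
proof (intro ballI allI impI)
  fix a :: 'a and n :: nat assume "0 < n"
  then show "\<exists>b\<in>carrier (additive_group UNIV). of_nat n * b = a"
    by (intro bexI[of _ "a / of_nat n"]) (auto simp: additive_group_def)
qed

text \<open>Stated for every field of characteristic 0 in order to serve the reals and the rationals
  at once.\<close>

lemma Mod_Ints:
  shows comm_group_Mod_Ints: "comm_group (additive_group (UNIV :: 'a::field_char_0 set) Mod \<int>)"
    and divisible_Mod_Ints: "divisible (additive_group (UNIV :: 'a set) Mod \<int>)"
proof -
  interpret comm_group "additive_group (UNIV :: 'a set)" by (rule additive_group_UNIV)
  have sub: "subgroup \<int> (additive_group (UNIV :: 'a set))"
    by (rule subgroup_Ints_additive_group) (use comm_group_axioms in auto)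
  then show "comm_group (additive_group (UNIV :: 'a set) Mod \<int>)" by (rule abelian_FactGroup)
  show "divisible (additive_group (UNIV :: 'a set) Mod \<int>)"
  proof (rule divisible_Mod)
    show "\<int> \<lhd> additive_group (UNIV :: 'a set)" using sub normal_iff_subgroup by blast
    show "\<exists>y\<in>carrier (additive_group UNIV). \<exists>z\<in>\<int>. y [^]\<^bsub>additive_group UNIV\<^esub> n = z \<otimes>\<^bsub>additive_group UNIV\<^esub> x"
      if "x \<in> carrier (additive_group UNIV)" "0 < n" for x :: 'a and n :: nat
      using divisible_additive_group_UNIV that l_one unfolding divisible_def
      by (metis Ints_0 additive_group_def monoid.simps(2))
  qed
qed

text \<open>To divide by n, split off its p-part: powers of p are invertible in Z[1/p], and the
  cofactor m is invertible modulo the denominator of the given element, which suffices modulo the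
  integers.\<close>

lemma int_adjoin_inverse_mod_int:
  assumes p: "prime p"
  shows comm_group_int_adjoin_inverse_mod_int: "comm_group (int_adjoin_inverse_mod_int p)"
    and divisible_int_adjoin_inverse_mod_int: "divisible (int_adjoin_inverse_mod_int p)"
proof -
  let ?S = "{of_int a / of_nat p ^ n | a n. True} :: rat set"
  have p0: "p > 0" using p prime_gt_0_nat by blast
  have S: "comm_group (additive_group ?S)"
  proof (rule comm_group_additive_group)
    show "0 \<in> ?S" by (auto intro!: exI[of _ 0])
    show "x + y \<in> ?S" if "x \<in> ?S" "y \<in> ?S" for x y
    proof -
      obtain a m b n where "x = of_int a / of_nat p ^ m" "y = of_int b / of_nat p ^ n"
        using \<open>x \<in> ?S\<close> \<open>y \<in> ?S\<close> by blast
      then have "x + y = of_int (a * int p ^ n + b * int p ^ m) / of_nat p ^ (m + n)"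
        using p0 by (simp add: add_frac_eq power_add)
      then show ?thesis by blast
    qed
    show "- x \<in> ?S" if "x \<in> ?S" for x
    proof -
      obtain a n where "x = of_int a / of_nat p ^ n" using \<open>x \<in> ?S\<close> by blast
      then have "- x = of_int (- a) / of_nat p ^ n" by simp
      then show ?thesis by blast
    qed
  qed
  interpret S: comm_group "additive_group ?S" by (rule S)
  have "\<int> \<subseteq> ?S"
  proof
    fix x :: rat assume "x \<in> \<int>"
    then obtain a where "x = of_int a / of_nat p ^ 0" by (auto elim: Ints_cases)
    then show "x \<in> ?S" by blast
  qed
  then have sub: "subgroup \<int> (additive_group ?S)"
    using S by (rule subgroup_Ints_additive_group)
  then show "comm_group (int_adjoin_inverse_mod_int p)"
    unfolding int_adjoin_inverse_mod_int_def int_adjoin_inverse_def by (rule S.abelian_FactGroup)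
  have "divisible (additive_group ?S Mod \<int>)"
  proof (rule divisible_Mod)
    show "\<int> \<lhd> additive_group ?S" using sub S.normal_iff_subgroup by blast
    fix x and n :: nat assume "x \<in> carrier (additive_group ?S)" and n: "0 < n"
    then obtain a j where x: "x = of_int a / of_nat p ^ j" unfolding additive_group_def by auto
    obtain k m where m: "n = p ^ k * m" "\<not> p dvd m"
      using n p by (metis multiplicity_decompose' not_prime_unit neq0_conv)
    have "coprime (int m) (int p ^ j)"
      using m(2) p by (metis coprime_commute coprime_int_iff coprime_power_left_iff of_nat_power prime_imp_coprime)
    then obtain u v where uv: "u * int m + v * int p ^ j = 1"
      by (metis bezout_int coprime_imp_gcd_eq_1)
    \<comment> \<open>By Bezout \<open>u * m\<close> is \<open>1 - v * p ^ j\<close>, so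
      \<open>n\<close> times \<open>?y\<close> is \<open>a / p ^ j\<close> minus the integer
      \<open>a * v\<close>.\<close>
    let ?y = "of_int (a * u) / of_nat p ^ (j + k) :: rat"
    have "of_int (u * int m + v * int p ^ j) = (1::rat)" unfolding uv by simp
    then have um: "of_int u * of_nat m = 1 - of_int v * (of_nat p :: rat) ^ j" by simp
    have "of_nat n * ?y = of_int a * (of_int u * of_nat m) / of_nat p ^ j"
      using p0 unfolding m(1) by (simp add: field_simps power_add)
    also have "\<dots> = of_int (- a * v) + x"
      unfolding um x using p0 by (simp add: field_simps)
    finally have "?y [^]\<^bsub>additive_group ?S\<^esub> n = of_int (- a * v) \<otimes>\<^bsub>additive_group ?S\<^esub> x"
      unfolding nat_pow_additive_group by (simp add: additive_group_def)
    moreover have "?y \<in> carrier (additive_group ?S)" unfolding additive_group_def partial_object.simps by blast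
    ultimately show "\<exists>y\<in>carrier (additive_group ?S). \<exists>z\<in>\<int>.
        y [^]\<^bsub>additive_group ?S\<^esub> n = z \<otimes>\<^bsub>additive_group ?S\<^esub> x"
      by (meson Ints_of_int)
  qed
  then show "divisible (int_adjoin_inverse_mod_int p)"
    unfolding int_adjoin_inverse_mod_int_def int_adjoin_inverse_def .
qed

lemma comm_group_complex_units: "comm_group complex_units"
  unfolding complex_units_def by (rule comm_group_multiplicative_group) auto

lemma divisible_complex_units: "divisible complex_units"
  unfolding divisible_def complex_units_def nat_pow_multiplicative_group
proof (intro ballI allI impI)
  fix a :: complex and n :: nat
  assume a: "a \<in> carrier (multiplicative_group (UNIV - {0}))" and n: "0 < n"
  \<comment> \<open>A root in polar form; it is nonzero because its \<open>n\<close>-th power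
    is.\<close>
  let ?b = "rcis (root n (cmod a)) (Arg a / n)"
  have "?b ^ n = a" using n by (simp add: DeMoivre2 rcis_cmod_Arg)
  moreover from this have "?b \<noteq> 0" using a n by (auto simp: multiplicative_group_def power_0_left)
  ultimately show "\<exists>b\<in>carrier (multiplicative_group (UNIV - {0})). b ^ n = a"
    by (intro bexI[of _ ?b]) (simp_all add: multiplicative_group_def)
qed

lemma comm_group_pos_reals: "comm_group pos_reals"
  unfolding pos_reals_def by (rule comm_group_multiplicative_group) auto

lemma divisible_pos_reals: "divisible pos_reals"
  unfolding divisible_def pos_reals_def nat_pow_multiplicative_group
proof (intro ballI allI impI)
  fix a :: real and n :: nat
  assume "a \<in> carrier (multiplicative_group {0<..})" "0 < n"
  then show "\<exists>b\<in>carrier (multiplicative_group {0<..}). b ^ n = a"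
    by (intro bexI[of _ "root n a"]) (auto simp: multiplicative_group_def)
qed

section \<open>Groups of rank one\<close>

lemma torsion_free_int_pow:
  assumes "comm_group G" "torsion_free G" "x \<in> carrier G" "x [^]\<^bsub>G\<^esub> (n::int) = \<one>\<^bsub>G\<^esub>"
  shows "n = 0 \<or> x = \<one>\<^bsub>G\<^esub>"
proof -
  interpret G: comm_group G by fact
  have "x [^]\<^bsub>G\<^esub> nat \<bar>n\<bar> = \<one>\<^bsub>G\<^esub>"
    using assms(3,4) G.int_pow_neg[OF assms(3), of n]
    by (simp add: abs_if int_pow_int[symmetric])
  moreover have "0 < nat \<bar>n\<bar>" if "n \<noteq> 0" using that by simp
  ultimately show ?thesis using assms(2,3) unfolding torsion_free_def by blast
qed

text \<open>Since \<open>x\<close> has infinite order, sending its \<open>n\<close>-th power to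
  \<open>n\<close> is well defined on the cyclic subgroup it generates; divisibility of the
  rationals extends this map to \<open>G\<close>.\<close>

lemma torsion_free_rational_character:
  assumes G: "comm_group G" and tf: "torsion_free G" and x: "x \<in> carrier G" "x \<noteq> \<one>\<^bsub>G\<^esub>"
  shows "\<exists>f\<in>hom G rat_add. f x = 1"
proof -
  interpret G: comm_group G by (rule G)
  have Q: "comm_group rat_add" "divisible rat_add"
    using additive_group_UNIV divisible_additive_group_UNIV unfolding rat_add_def by blast+
  let ?\<iota> = "\<lambda>n::int. (x [^]\<^bsub>G\<^esub> n, of_int n :: rat)"
  have "?\<iota> \<in> hom integer_group (G \<times>\<times> rat_add)"
    using x(1) by (intro homI) (auto simp: G.int_pow_mult)
  then have "subgroup (range ?\<iota>) (G \<times>\<times> rat_add)"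
    using group_hom.img_is_subgroup[of integer_group "G \<times>\<times> rat_add" ?\<iota>]
      DirProd_group[OF G.is_group comm_group.axioms(2)[OF Q(1)]]
    by (simp add: group_hom_def group_hom_axioms_def)
  moreover have "a = \<one>\<^bsub>rat_add\<^esub>" if "(\<one>\<^bsub>G\<^esub>, a) \<in> range ?\<iota>" for a
    using that torsion_free_int_pow[OF G tf x(1)] x(2) by force
  ultimately have "\<exists>f\<in>hom G rat_add. \<forall>(y, a)\<in>range ?\<iota>. f y = a"
    by (rule divisible_extension[OF G Q])
  then obtain f where f: "f \<in> hom G rat_add" "\<forall>(y, a)\<in>range ?\<iota>. f y = a" by (rule bexE)
  have "f (x [^]\<^bsub>G\<^esub> (1::int)) = of_int 1" using bspec[OF f(2) rangeI[of ?\<iota> 1]] by simp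
  with f(1) show ?thesis using x(1) by auto
qed

text \<open>\<open>F\<close> is the linear functional sending the tensor of \<open>q\<close> and
  \<open>g\<close> to \<open>q * f g\<close>. It is kept on the free abelian group, together with
  its vanishing on the relations, so that evaluations use representatives instead of cosets.\<close>

lemma tensor_functional:
  assumes G: "comm_group G" and f: "f \<in> hom G rat_add"
  obtains F :: "(rat \<times> 'g \<Rightarrow>\<^sub>0 int) \<Rightarrow> rat"
  where "\<And>s t. s \<in> carrier (tensor_free G) \<Longrightarrow> t \<in> carrier (tensor_free G) \<Longrightarrow> F (s + t) = F s + F t"
    and "\<And>q g. g \<in> carrier G \<Longrightarrow> F (frag_of (q, g)) = q * f g"
    and "\<And>t. t \<in> tensor_null G \<Longrightarrow> F t = 0"
    and "\<And>q t. t \<in> carrier (tensor_free G) \<Longrightarrow> F (tensor_scale q t) = q * F t"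
proof -
  interpret Q: comm_group rat_add
    using additive_group_UNIV unfolding rat_add_def .
  interpret G: comm_group G by (rule G)
  interpret T: comm_group "tensor_free G" by (rule abelian_free_Abelian_group)
  obtain F where F: "F \<in> hom (tensor_free G) rat_add"
    and frag': "\<And>u. u \<in> UNIV \<times> carrier G \<Longrightarrow> F (frag_of u) = (\<lambda>(q, g). q * f g) u"
    by (rule Q.free_Abelian_group_universal[of "\<lambda>(q, g). q * f g" "UNIV \<times> carrier G"]) auto
  interpret F: group_hom "tensor_free G" rat_add F
    using F by unfold_locales
  have frag: "F (frag_of (q, g)) = q * f g" if "g \<in> carrier G" for q g
    using frag' that by simp
  have add: "F (s + t) = F s + F t" if "s \<in> carrier (tensor_free G)" "t \<in> carrier (tensor_free G)" for s t
    using F.hom_mult[OF that] by simp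
  have carr_diff: "s - t \<in> carrier (tensor_free G)"
    if "s \<in> carrier (tensor_free G)" "t \<in> carrier (tensor_free G)" for s t
    using that keys_diff[of s t] by auto
  have diff: "F (s - t) = F s - F t" if "s \<in> carrier (tensor_free G)" "t \<in> carrier (tensor_free G)" for s t
    using add[OF carr_diff[OF that] that(2)] by simp
  have fr [simp]: "frag_of (q, g) \<in> carrier (tensor_free G)" if "g \<in> carrier G" for q g
    using that by simp
  have "tensor_relations G \<subseteq> kernel (tensor_free G) rat_add F"
  proof
    fix t assume t: "t \<in> tensor_relations G"
    from t consider
      (left) q r g where "g \<in> carrier G" "t = frag_of (q + r, g) - frag_of (q, g) - frag_of (r, g)"
    | (right) q g h where "g \<in> carrier G" "h \<in> carrier G"
        "t = frag_of (q, g \<otimes>\<^bsub>G\<^esub> h) - frag_of (q, g) - frag_of (q, h)"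
      unfolding tensor_relations_def by blast
    then have "F t = 0"
    proof cases
      case left
      then show ?thesis by (simp only: diff carr_diff fr frag) (simp add: distrib_right)
    next
      case right
      moreover have "g \<otimes>\<^bsub>G\<^esub> h \<in> carrier G" using right(1,2) by (rule G.m_closed)
      ultimately show ?thesis
        by (simp only: diff carr_diff fr frag hom_mult[OF f] rat_add_simps) (simp add: distrib_left)
    qed
    then show "t \<in> kernel (tensor_free G) rat_add F"
      using subsetD[OF tensor_relations_subset[OF G] t] unfolding kernel_def by simp
  qed
  then have "tensor_null G \<subseteq> kernel (tensor_free G) rat_add F"
    unfolding tensor_null_def using F.subgroup_kernel by (rule T.generate_subgroup_incl)
  then have null: "F t = 0" if "t \<in> tensor_null G" for t
    using that unfolding kernel_def by auto
  have scale: "F (tensor_scale q t) = q * F t" if "t \<in> carrier (tensor_free G)" for q t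
  proof -
    from that have "Poly_Mapping.keys t \<subseteq> UNIV \<times> carrier G" by simp
    then show ?thesis
    proof (induction t rule: free_Abelian_group_induct[consumes 1, case_names zero diff base])
      case zero
      show ?case using F.hom_one by (simp add: tensor_scale_zero[OF G])
    next
      case (diff s t)
      then show ?case
        using tensor_scale_closed[OF G, of s q] tensor_scale_closed[OF G, of t q]
        by (simp add: tensor_scale_diff[OF G] \<open>\<And>s t. _ \<Longrightarrow> _ \<Longrightarrow> F (s - t) = F s - F t\<close> algebra_simps)
    next
      case (base u)
      then show ?case by (cases u) (simp add: tensor_scale_frag_of[OF G] frag)
    qed
  qed
  show ?thesis by (rule that[OF add frag null scale])
qed

text \<open>Dimension one in terms of representatives: \<open>y\<close> represents the single basis
  vector, and a linear combination over a singleton is a scalar multiple.\<close>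

lemma rank_one_spanned:
  assumes G: "comm_group G" and fin: "finite_rank G" and rank: "group_rank G = 1"
  obtains y where "y \<in> carrier (tensor_free G)"
    "\<And>t. t \<in> carrier (tensor_free G) \<Longrightarrow> \<exists>q. \<exists>n\<in>tensor_null G. t = n + tensor_scale q y"
proof -
  let ?F = "tensor_free G" and ?N = "tensor_null G"
  interpret V: vectorspace "class_ring :: rat ring" "rat_tensor G"
    by (rule vectorspace_rat_tensor[OF G])
  interpret N: normal ?N ?F by (rule tensor_null_normal[OF G])
  obtain B where B: "finite B" "V.basis B"
    using V.finite_basis_exists fin unfolding finite_rank_def by blast
  then have "card B = 1" using V.dim_basis rank unfolding group_rank_def by simp
  then obtain v where v: "B = {v}" by (rule card_1_singletonE)
  have vV: "v \<in> carrier (rat_tensor G)" and span: "V.span {v} = carrier (rat_tensor G)"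
    using B(2) unfolding v V.basis_def by auto
  have carr: "carrier (rat_tensor G) = carrier (?F Mod ?N)" unfolding rat_tensor_def by simp
  obtain y where y: "y \<in> carrier ?F" "v = ?N #>\<^bsub>?F\<^esub> y"
    using vV unfolding carr carrier_FactGroup by blast
  have "\<exists>q. \<exists>n\<in>?N. t = n + tensor_scale q y" if t: "t \<in> carrier ?F" for t
  proof -
    have "?N #>\<^bsub>?F\<^esub> t \<in> V.span {v}"
      unfolding span carr carrier_FactGroup using t by blast
    then obtain a where "V.lincomb a {v} = ?N #>\<^bsub>?F\<^esub> t"
      using V.finite_in_span[of "{v}"] vV by auto
    then have "?N #>\<^bsub>?F\<^esub> t = a v \<odot>\<^bsub>rat_tensor G\<^esub> v"
      using vV unfolding V.lincomb_def by simp
    also have "\<dots> = ?N #>\<^bsub>?F\<^esub> tensor_scale (a v) y"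
      unfolding y(2) by (rule rat_tensor_smult[OF G y(1)])
    finally have "t \<in> ?N #>\<^bsub>?F\<^esub> tensor_scale (a v) y"
      using N.rcos_self[OF t tensor_null_subgroup[OF G]] by simp
    then show ?thesis unfolding r_coset_def by auto
  qed
  with y(1) show ?thesis by (rule that)
qed

text \<open>On a line, a functional that is not zero has trivial kernel. If \<open>f\<close> killed
  some nontrivial \<open>g\<close>, the class of \<open>g\<close> in the tensor product would be
  zero, yet another character detects \<open>g\<close>.\<close>

lemma rank_one_embeds_rat:
  assumes G: "comm_group G" and tf: "torsion_free G" and fin: "finite_rank G" and rank: "group_rank G = 1"
  shows "\<exists>f\<in>hom G rat_add. inj_on f (carrier G)"
proof (cases "carrier G = {\<one>\<^bsub>G\<^esub>}")
  \<comment> \<open>The trivial group has rank 0, but the zero map disposes of it without computing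
    that rank.\<close>
  case True
  have "(\<lambda>_. 0) \<in> hom G rat_add" by (simp add: hom_def)
  then show ?thesis using True by (intro bexI[of _ "\<lambda>_. 0"]) auto
next
  case False
  interpret G: comm_group G by (rule G)
  obtain x where x: "x \<in> carrier G" "x \<noteq> \<one>\<^bsub>G\<^esub>" using False G.one_closed by blast
  obtain f where f: "f \<in> hom G rat_add" "f x = 1"
    using torsion_free_rational_character[OF G tf x] by blast
  obtain y where y: "y \<in> carrier (tensor_free G)"
    and span: "\<And>t. t \<in> carrier (tensor_free G) \<Longrightarrow> \<exists>q. \<exists>n\<in>tensor_null G. t = n + tensor_scale q y"
    using rank_one_spanned[OF G fin rank] by blast
  interpret f: group_hom G rat_add f
    using f(1) additive_group_UNIV comm_group.axioms(2) G.is_group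
    unfolding group_hom_def group_hom_axioms_def rat_add_def by blast
  have "g = \<one>\<^bsub>G\<^esub>" if g: "g \<in> carrier G" "f g = 0" for g
  proof (rule ccontr)
    assume "g \<noteq> \<one>\<^bsub>G\<^esub>"
    then obtain f' where f': "f' \<in> hom G rat_add" "f' g = 1"
      using torsion_free_rational_character[OF G tf g(1)] by blast
    obtain F where F: "\<And>s t. s \<in> carrier (tensor_free G) \<Longrightarrow> t \<in> carrier (tensor_free G) \<Longrightarrow> F (s + t) = F s + F t"
      "\<And>q g. g \<in> carrier G \<Longrightarrow> F (frag_of (q, g)) = q * f g" "\<And>t. t \<in> tensor_null G \<Longrightarrow> F t = 0"
      "\<And>q t. t \<in> carrier (tensor_free G) \<Longrightarrow> F (tensor_scale q t) = q * F t"
      by (rule tensor_functional[OF G f(1)]) blast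
    obtain F' where F': "\<And>s t. s \<in> carrier (tensor_free G) \<Longrightarrow> t \<in> carrier (tensor_free G) \<Longrightarrow> F' (s + t) = F' s + F' t"
      "\<And>q g. g \<in> carrier G \<Longrightarrow> F' (frag_of (q, g)) = q * f' g" "\<And>t. t \<in> tensor_null G \<Longrightarrow> F' t = 0"
      "\<And>q t. t \<in> carrier (tensor_free G) \<Longrightarrow> F' (tensor_scale q t) = q * F' t"
      by (rule tensor_functional[OF G f'(1)]) blast
    note null = subgroup.mem_carrier[OF tensor_null_subgroup[OF G]]
    have frag: "frag_of (1, z) \<in> carrier (tensor_free G)" if "z \<in> carrier G" for z
      using that by simp
    obtain q n where q: "n \<in> tensor_null G" "frag_of (1, g) = n + tensor_scale q y"
      using span[OF frag[OF g(1)]] by blast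
    obtain r m where r: "m \<in> tensor_null G" "frag_of (1, x) = m + tensor_scale r y"
      using span[OF frag[OF x(1)]] by blast
    \<comment> \<open>Evaluation at \<open>x\<close> shows that \<open>F y\<close> is nonzero;
      evaluation at \<open>g\<close> then forces \<open>q = 0\<close>, against
      \<open>f' g = 1\<close>.\<close>
    have "r * F y = 1"
      using F(1)[OF null[OF r(1)] tensor_scale_closed[OF G y]] F(2)[OF x(1), of 1] F(3)[OF r(1)] F(4)[OF y] f(2)
      unfolding r(2) by simp
    moreover have "q * F y = 0"
      using F(1)[OF null[OF q(1)] tensor_scale_closed[OF G y]] F(2)[OF g(1), of 1] F(3)[OF q(1)] F(4)[OF y] g(2)
      unfolding q(2) by simp
    ultimately have "q = 0" by auto
    then show False
      using F'(1)[OF null[OF q(1)] tensor_scale_closed[OF G y]] F'(2)[OF g(1), of 1] F'(3)[OF q(1)] F'(4)[OF y] f'(2)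
      unfolding q(2) by simp
  qed
  then have "inj_on f (carrier G)" using f.inj_on_one_iff by simp
  with f(1) show ?thesis by blast
qed

text \<open>Two rationals generate a cyclic group: over a common denominator the generator is the
  gcd of the numerators. Bezout coefficients express it through \<open>g\<close> and
  \<open>h\<close>, and injectivity of \<open>f\<close> carries the relations back to
  \<open>G\<close>.\<close>

lemma embeds_rat_locally_cyclic:
  assumes G: "comm_group G" and f: "f \<in> hom G rat_add" "inj_on f (carrier G)"
    and gh: "g \<in> carrier G" "h \<in> carrier G"
  shows "\<exists>x\<in>carrier G. \<exists>(m::int) (n::int). g = x [^]\<^bsub>G\<^esub> m \<and> h = x [^]\<^bsub>G\<^esub> n"
proof -
  interpret G: comm_group G by (rule G)
  interpret f: group_hom G rat_add f
    using f(1) additive_group_UNIV comm_group.axioms(2) G.is_group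
    unfolding group_hom_def group_hom_axioms_def rat_add_def by blast
  have add: "f (x \<otimes>\<^bsub>G\<^esub> y) = f x + f y" if "x \<in> carrier G" "y \<in> carrier G" for x y
    using f.hom_mult[OF that] by simp
  have nat_pow: "f (x [^]\<^bsub>G\<^esub> k) = of_nat k * f x" if "x \<in> carrier G" for x and k :: nat
    using f.hom_nat_pow[OF that, of k] by (simp add: rat_add_def nat_pow_additive_group)
  have inv: "f (inv\<^bsub>G\<^esub> x) = - f x" if "x \<in> carrier G" for x
  proof -
    have "f x + f (inv\<^bsub>G\<^esub> x) = 0" using that f.hom_one by (simp flip: add del: f.hom_inv)
    then show ?thesis by (simp only: add_eq_0_iff)
  qed
  have pow: "f (x [^]\<^bsub>G\<^esub> k) = of_int k * f x" if "x \<in> carrier G" for x and k :: int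
    using that
    by (cases k rule: int_cases2) (simp_all add: int_pow_int G.int_pow_neg_int nat_pow inv del: f.hom_inv)
  obtain a c where ac: "f g = of_int a / of_int c" "c > 0"
    using quotient_of_div quotient_of_denom_pos by (cases "quotient_of (f g)") blast
  obtain b d where bd: "f h = of_int b / of_int d" "d > 0"
    using quotient_of_div quotient_of_denom_pos by (cases "quotient_of (f h)") blast
  define e where "e = gcd (a * d) (b * c)"
  obtain u v where uv: "u * (a * d) + v * (b * c) = e"
    using bezout_int unfolding e_def by blast
  \<comment> \<open>Cofactors come from divisibility, not from division by \<open>e\<close>, so
    \<open>e = 0\<close>, the case of two trivial elements, needs no separate treatment.\<close>
  obtain m n where mn: "a * d = e * m" "b * c = e * n"
    unfolding e_def by (meson dvdE gcd_dvd1 gcd_dvd2)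
  define x where "x = g [^]\<^bsub>G\<^esub> u \<otimes>\<^bsub>G\<^esub> h [^]\<^bsub>G\<^esub> v"
  have x: "x \<in> carrier G" unfolding x_def using gh by simp
  have cd: "of_int c \<noteq> (0::rat)" "of_int d \<noteq> (0::rat)" using ac(2) bd(2) by auto
  have fg: "f g = of_int (a * d) / of_int (c * d)" and fh: "f h = of_int (b * c) / of_int (c * d)"
    using cd unfolding ac(1) bd(1) by simp_all
  have "f x = of_int u * f g + of_int v * f h" unfolding x_def using gh by (simp add: add pow)
  also have "\<dots> = of_int e / of_int (c * d)"
    unfolding fg fh uv[symmetric] by (simp add: add_divide_distrib)
  finally have fx: "f x = of_int e / of_int (c * d)" .
  have "f g = f (x [^]\<^bsub>G\<^esub> m)" "f h = f (x [^]\<^bsub>G\<^esub> n)"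
    unfolding pow[OF x] fx fg fh mn by (simp_all add: mult.commute)
  then have "g = x [^]\<^bsub>G\<^esub> m" "h = x [^]\<^bsub>G\<^esub> n"
    using inj_onD[OF f(2)] gh x by auto
  then show ?thesis using x by blast
qed

text \<open>Any two elements are powers of a common one, and on such pairs
  \<open>Z2_powers_commute\<close> gives symmetry.\<close>

lemma rank_one_Z2_symmetric:
  assumes G: "comm_group G" and tf: "torsion_free G" and fin: "finite_rank G" and rank: "group_rank G = 1"
    and A: "comm_group A" and \<phi>: "\<phi> \<in> Z2 G A"
  shows "symmetric_on G \<phi>"
  unfolding symmetric_on_def
proof (intro ballI)
  fix g h assume gh: "g \<in> carrier G" "h \<in> carrier G"
  obtain f where "f \<in> hom G rat_add" "inj_on f (carrier G)"
    using rank_one_embeds_rat[OF G tf fin rank] by blast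
  then obtain x and m n :: int where "x \<in> carrier G" "g = x [^]\<^bsub>G\<^esub> m" "h = x [^]\<^bsub>G\<^esub> n"
    using embeds_rat_locally_cyclic[OF G _ _ gh] by blast
  then show "\<phi> (g, h) = \<phi> (h, g)"
    using Z2_powers_commute[OF comm_group.axioms(2)[OF G] A \<phi>] by simp
qed

lemma trivial_H2_rank_one:
  assumes "comm_group G" "torsion_free G" "finite_rank G" "group_rank G = 1"
    and "comm_group A" "divisible A"
  shows "trivial_group (H2 G A)"
  using H2_eq_H2_sym[OF assms(1,5)] rank_one_Z2_symmetric[OF assms(1-5)]
    trivial_H2_sym[OF comm_group.axioms(2)[OF assms(1)] assms(5,1,6)] by simp

theorem corollary5p20:
  fixes G :: "('g, 'm) monoid_scheme"
  assumes "comm_group G" and "torsion_free G" and "finite_rank G"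
  shows "trivial_group (H2_sym G complex_units)
    \<and> (trivial_group (H2_sym G pos_reals)
       \<and> trivial_group (H2_sym G real_add)
       \<and> trivial_group (H2_sym G real_mod_int))
    \<and> (trivial_group (H2_sym G rat_add)
       \<and> trivial_group (H2_sym G rat_mod_int)
       \<and> (\<forall>p::nat. prime p \<longrightarrow> trivial_group (H2_sym G (int_adjoin_inverse_mod_int p))))
    \<and> (group_rank G = 1 \<longrightarrow>
         trivial_group (H2 G rat_add)
       \<and> trivial_group (H2 G rat_mod_int)
       \<and> (\<forall>p::nat. prime p \<longrightarrow> trivial_group (H2 G (int_adjoin_inverse_mod_int p))))"
proof -
  note sym = trivial_H2_sym[OF comm_group.axioms(2)[OF assms(1)] _ assms(1)]
  note all = trivial_H2_rank_one[OF assms]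
  note coeff = comm_group_complex_units divisible_complex_units comm_group_pos_reals divisible_pos_reals
    additive_group_UNIV divisible_additive_group_UNIV comm_group_Mod_Ints divisible_Mod_Ints
    comm_group_int_adjoin_inverse_mod_int divisible_int_adjoin_inverse_mod_int
  show ?thesis
    \<comment> \<open>Unfolding exposes the reals and the rationals as instances of
      \<open>additive_group UNIV\<close>, so the same facts settle both, with and without the
      quotient by the integers.\<close>
    unfolding real_mod_int_def real_add_def rat_mod_int_def rat_add_def
    by (intro conjI impI allI sym all coeff)
qed

end
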